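(* Let $\beta\in[0,1]$ and let $U:\mathbb{R}^d\to\mathbb{R}$ be twice continuously differentiable such that $\int e^{-U}<\infty$, there exists $L_1\ge0$ with $\|\nabla U(q)-\nabla U(\tilde q)\|\le L_1\|q-\tilde q\|$ for all $q,\tilde q$, and there exists $M_1\ge0$ with $\|\nabla U(q)\|\le M_1(1+\|q\|^\beta)$ for all $q$. Then for every $T\in\mathbb{N}^*$ there exists $\tilde h_T>0$ such that for every $h\in(0,\tilde h_T]$, the HMC kernel $P_{h,T}$ is irreducible, the Lebesgue measure is an irreducibility measure for it, and $P_{h,T}$ is aperiodic and Harris recurrent. Consequently, for all $q\in\mathbb{R}^d$, $\lim_{n\to\infty}\|\delta_q P_{h,T}^n-\pi\|_{TV}=0$.
   Context: $\pi$ is the probability density on $\mathbb{R}^d$ proportional to $e^{-U}$. $H(q,p)=U(q)+\|p\|^2/2$. For $h>0$, the leapfrog map is $\Phi_h=\Psi^{(1)}_h\circ\Psi^{(2)}_h\circ\Psi^{(1)}_h$ with $\Psi^{(1)}_h(q,p)=(q,p-(h/2)\nabla U(q))$, $\Psi^{(2)}_h(q,p)=(q+hp,p)$; $\Phi_h^{\circ T}$ is its $T$-fold composition and $\Phi^{q,T}_h$ the position (first) component of $\Phi_h^{\circ T}$. Let $\alpha_H((q,p),(\tilde q,\tilde p))=\min[1,\exp(H(q,p)-H(\tilde q,\tilde p))]$ and $\varphi(p)=(2\pi)^{-d/2}e^{-\|p\|^2/2}$. The HMC kernel is the Markov kernel on $\mathbb{R}^d$ $$P_{h,T}(q,A)=\int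 1_A(\Phi^{q,T}_h(q,p))\,\alpha_H((q,p),\Phi_h^{\circ T}(q,p))\varphi(p)\,dp+\delta_q(A)\int[1-\alpha_H((q,p),\Phi_h^{\circ T}(q,p))]\varphi(p)\,dp.$$ A Markov kernel $P$ is irreducible with irreducibility measure $\mu$ (a nontrivial $\sigma$-finite measure) if every Borel set $A$ with $\mu(A)>0$ is accessible, i.e. $\sum_{m\ge1}P^m(x,A)>0$ for all $x$. $P$ is Harris recurrent if for every accessible set $A$ and every $x$, the chain started at $x$ visits $A$ infinitely often almost surely. $\|\cdot\|_{TV}$ is the total variation norm. *)

theory Defs
  imports "HOL-Probability.Probability"
begin

definition gradient :: "('a::euclidean_space \<Rightarrow> real) \<Rightarrow> 'a \<Rightarrow> 'a" where
  "gradient U q = (SOME g. (U has_derivative (\<lambda>v. g \<bullet> v)) (at q))"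

definition C2 :: "('a::euclidean_space \<Rightarrow> real) \<Rightarrow> bool" where
  "C2 U \<longleftrightarrow> (\<forall>q. U differentiable (at q)) \<and>
     (\<exists>D2 :: 'a \<Rightarrow> ('a \<Rightarrow>\<^sub>L 'a).
        (\<forall>q. (gradient U has_derivative blinfun_apply (D2 q)) (at q)) \<and> continuous_on UNIV D2)"

definition ham :: "('a::euclidean_space \<Rightarrow> real) \<Rightarrow> 'a \<times> 'a \<Rightarrow> real" where
  "ham U z = U (fst z) + (norm (snd z))\<^sup>2 / 2"

definition psi1 :: "('a::euclidean_space \<Rightarrow> real) \<Rightarrow> real \<Rightarrow> 'a \<times> 'a \<Rightarrow> 'a \<times> 'a" where
  "psi1 U h z = (fst z, snd z - (h / 2) *\<^sub>R gradient U (fst z))"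

definition psi2 :: "real \<Rightarrow> 'a::euclidean_space \<times> 'a \<Rightarrow> 'a \<times> 'a" where
  "psi2 h z = (fst z + h *\<^sub>R snd z, snd z)"

definition leapfrog :: "('a::euclidean_space \<Rightarrow> real) \<Rightarrow> real \<Rightarrow> 'a \<times> 'a \<Rightarrow> 'a \<times> 'a" where
  "leapfrog U h = psi1 U h \<circ> psi2 h \<circ> psi1 U h"

definition leapfrog_iter :: "('a::euclidean_space \<Rightarrow> real) \<Rightarrow> real \<Rightarrow> nat \<Rightarrow> 'a \<times> 'a \<Rightarrow> 'a \<times> 'a" where
  "leapfrog_iter U h T = (leapfrog U h ^^ T)"

definition accept :: "('a::euclidean_space \<Rightarrow> real) \<Rightarrow> 'a \<times> 'a \<Rightarrow> 'a \<times> 'a \<Rightarrow> real" where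
  "accept U z z' = min 1 (exp (ham U z - ham U z'))"

definition std_gauss :: "'a::euclidean_space \<Rightarrow> real" where
  "std_gauss p = (2 * pi) powr (- real DIM('a) / 2) * exp (- (norm p)\<^sup>2 / 2)"

definition hmc_kernel :: "('a::euclidean_space \<Rightarrow> real) \<Rightarrow> real \<Rightarrow> nat \<Rightarrow> 'a \<Rightarrow> 'a measure" where
  "hmc_kernel U h T q = measure_of UNIV (sets borel)
     (\<lambda>A. (\<integral>\<^sup>+p. ennreal (indicator A (fst (leapfrog_iter U h T (q, p)))
                    * accept U (q, p) (leapfrog_iter U h T (q, p)) * std_gauss p) \<partial>lborel)
        + indicator A q * (\<integral>\<^sup>+p. ennreal ((1 - accept U (q, p) (leapfrog_iter U h T (q, p)))
                    * std_gauss p) \<partial>lborel))"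

definition target :: "('a::euclidean_space \<Rightarrow> real) \<Rightarrow> 'a measure" where
  "target U = density lborel (\<lambda>q. ennreal (exp (- U q) / (\<integral>x. exp (- U x) \<partial>lborel)))"

primrec kpow :: "('a::topological_space \<Rightarrow> 'a measure) \<Rightarrow> nat \<Rightarrow> 'a \<Rightarrow> 'a measure" where
  "kpow K 0 x = return borel x"
| "kpow K (Suc m) x = K x \<bind> kpow K m"

definition accessible :: "('a::topological_space \<Rightarrow> 'a measure) \<Rightarrow> 'a set \<Rightarrow> bool" where
  "accessible K A \<longleftrightarrow> (\<forall>x. (\<Sum>m. emeasure (kpow K (Suc m) x) A) > 0)"

definition irreducibility_measure :: "('a::topological_space \<Rightarrow> 'a measure) \<Rightarrow> 'a measure \<Rightarrow> bool" where
  "irreducibility_measure K \<mu> \<longleftrightarrow>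
     sets \<mu> = sets borel \<and> sigma_finite_measure \<mu> \<and> emeasure \<mu> (space \<mu>) \<noteq> 0 \<and>
     (\<forall>A \<in> sets borel. emeasure \<mu> A > 0 \<longrightarrow> accessible K A)"

definition irreducible :: "('a::topological_space \<Rightarrow> 'a measure) \<Rightarrow> bool" where
  "irreducible K \<longleftrightarrow> (\<exists>\<mu>. irreducibility_measure K \<mu>)"

text \<open>Aperiodicity (Meyn--Tweedie): the chain is irreducible and admits no d-cycle with d \<ge> 2.\<close>
definition aperiodic :: "('a::topological_space \<Rightarrow> 'a measure) \<Rightarrow> bool" where
  "aperiodic K \<longleftrightarrow> irreducible K \<and>
     (\<forall>\<psi>. irreducibility_measure K \<psi> \<longrightarrow>
        \<not> (\<exists>d::nat. d \<ge> 2 \<and> (\<exists>D :: nat \<Rightarrow> 'a set.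
              (\<forall>i<d. D i \<in> sets borel) \<and> disjoint_family_on D {..<d} \<and>
              (\<forall>i<d. \<forall>x\<in>D i. emeasure (K x) (D (Suc i mod d)) = 1) \<and>
              emeasure \<psi> (UNIV - (\<Union>i<d. D i)) = 0)))"

definition chain_law :: "('a::topological_space \<Rightarrow> 'a measure) \<Rightarrow> 'a \<Rightarrow> (nat \<Rightarrow> 'a) measure" where
  "chain_law K x = projective_family.lim UNIV
      (Ionescu_Tulcea.CI (\<lambda>i \<omega>. if i = 0 then return borel x else K (\<omega> (i - 1))) (\<lambda>_. borel))
      (\<lambda>_. borel)"

definition harris_recurrent :: "('a::topological_space \<Rightarrow> 'a measure) \<Rightarrow> bool" where
  "harris_recurrent K \<longleftrightarrow>
     (\<forall>A \<in> sets borel. accessible K A \<longrightarrow>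
        (\<forall>x. AE \<omega> in chain_law K x. infinite {n. \<omega> n \<in> A}))"

definition tv_norm :: "'a::topological_space measure \<Rightarrow> 'a measure \<Rightarrow> real" where
  "tv_norm \<mu> \<nu> = (SUP PA \<in> {(n::nat, A::nat \<Rightarrow> 'a set). (\<forall>i<n. A i \<in> sets borel) \<and> disjoint_family_on A {..<n}
                                  \<and> (\<Union>i<n. A i) = UNIV}.
        (\<Sum>i < fst PA. \<bar>measure \<mu> (snd PA i) - measure \<nu> (snd PA i)\<bar>))"

end

theory Submission
  imports Defs
begin

text \<open>
  If \<open>gradient U\<close> is Lipschitz with constant \<open>L\<close> and \<open>6 L (h T)\<^sup>2 \<le> 1\<close>, the position after \<open>T\<close>
  leapfrog steps is, as a function of the initial momentum \<open>p\<close>, a perturbation of \<open>h T p\<close> with Lipschitz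
  constant at most \<open>h T / 2\<close>, hence a bi-Lipschitz bijection. So the moving part of the kernel started
  at any point is equivalent to Lebesgue measure, while the remaining mass stays put. This gives
  irreducibility and aperiodicity in one step.

  The leapfrog map preserves volume and is inverted by momentum reversal, so the kernel is reversible
  with respect to \<open>\<pi>\<close>, i.e. self-adjoint on \<open>L\<^sup>2(\<pi>)\<close>. For bounded \<open>f\<close> with mean zero, \<open>P\<^sup>2\<^sup>n f\<close> is a Cauchy sequence
  whose limit must be constant, so \<open>P\<^sup>n f\<close> tends to \<open>0\<close>. By duality this yields convergence in total
  variation, uniformly over events, from any initial density, and then from any point by splitting
  off the atom of rejected moves, which has mass less than one. Harris recurrence follows by
  showing that the probability of never hitting a set of positive measure vanishes identically.
\<close>

text \<open>The obstacle is the atom of rejected moves: started at a point, the kernel may keep an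
  atom there under all its powers, so pointwise convergence cannot be read off from estimates in
  \<open>L\<^sup>2(\<pi>)\<close>. Hence the form of \<open>reversible_chain\<close>, which compares
  \<open>K x\<close> with \<pi> only away from \<open>x\<close>, and hence the use of functions
  defined everywhere instead of classes modulo null sets. Even powers replace the spectral theorem:
  the inner product of two even iterates is again the squared norm of an iterate, so the monotone
  convergence of the norms already gives the Cauchy property. The limit \<open>g\<close> is then
  only known to satisfy that \<open>P g\<close> and \<open>g\<close> have equal norms. Equality in
  Jensen's inequality makes it constant, which rules out the eigenvalues 1 (off the constants) and
  -1 at once. The 6 in the step-size condition is twice the 3 produced by the induction over
  leapfrog steps. It makes the relative error of the position 1/2: small enough for Banach's fixed
  point theorem and for a Lipschitz inverse. Bi-Lipschitz bijections preserve Lebesgue null sets in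
  both directions, so no Jacobian is computed.\<close>

section \<open>Bounded Borel functions\<close>

text \<open>This class carries all the \<open>L\<^sup>2\<close> arguments: it is integrable for
  every finite Borel measure, closed under the kernel operator, and keeps pointwise values, which
  the atom of \<open>K x\<close> at \<open>x\<close> can see.\<close>

definition bounded_borel :: "('a::topological_space \<Rightarrow> real) \<Rightarrow> bool" where
  "bounded_borel f \<longleftrightarrow> f \<in> borel_measurable borel \<and> (\<exists>B. \<forall>x. \<bar>f x\<bar> \<le> B)"

lemma bounded_borelI: "f \<in> borel_measurable borel \<Longrightarrow> (\<And>x. \<bar>f x\<bar> \<le> B) \<Longrightarrow> bounded_borel f"
  unfolding bounded_borel_def by auto

lemma bounded_borel_measurable: "bounded_borel f \<Longrightarrow> f \<in> borel_measurable borel"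
  unfolding bounded_borel_def by auto

lemma bounded_borelE:
  assumes "bounded_borel f" obtains B where "0 \<le> B" "\<And>x. \<bar>f x\<bar> \<le> B"
proof -
  obtain B where "\<And>x. \<bar>f x\<bar> \<le> B" using assms unfolding bounded_borel_def by auto
  moreover from this[of undefined] have "0 \<le> B" by linarith
  ultimately show ?thesis using that by blast
qed

lemma bounded_borel_const [simp, intro]: "bounded_borel (\<lambda>x. c)"
  by (rule bounded_borelI[where B="\<bar>c\<bar>"]) auto

lemma bounded_borel_add [intro]:
  assumes "bounded_borel f" "bounded_borel g" shows "bounded_borel (\<lambda>x. f x + g x)"
proof -
  obtain B C where "\<And>x. \<bar>f x\<bar> \<le> B" "\<And>x. \<bar>g x\<bar> \<le> C"
    using assms by (metis bounded_borel_def)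
  then have "\<bar>f x + g x\<bar> \<le> B + C" for x
    by (rule order_trans[OF abs_triangle_ineq add_mono])
  then show ?thesis
    using assms[THEN bounded_borel_measurable] by (intro bounded_borelI) auto
qed

lemma bounded_borel_mult [intro]:
  assumes "bounded_borel f" "bounded_borel g" shows "bounded_borel (\<lambda>x. f x * g x)"
proof -
  obtain B C where BC: "0 \<le> B" "\<And>x. \<bar>f x\<bar> \<le> B" "\<And>x. \<bar>g x\<bar> \<le> C"
    using assms by (metis bounded_borelE)
  then have "\<bar>f x * g x\<bar> \<le> B * C" for x by (simp add: abs_mult mult_mono)
  then show ?thesis
    using assms[THEN bounded_borel_measurable] by (intro bounded_borelI) auto
qed

lemma bounded_borel_diff [intro]:
  assumes "bounded_borel f" "bounded_borel g" shows "bounded_borel (\<lambda>x. f x - g x)"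
  using bounded_borel_add[OF assms(1) bounded_borel_mult[OF bounded_borel_const[of "-1"] assms(2)]] by simp

lemma bounded_borel_power2 [intro]: "bounded_borel f \<Longrightarrow> bounded_borel (\<lambda>x. (f x)\<^sup>2)"
  unfolding power2_eq_square by (rule bounded_borel_mult)

lemma bounded_borel_abs [intro]: "bounded_borel f \<Longrightarrow> bounded_borel (\<lambda>x. \<bar>f x\<bar>)"
  by (auto simp: bounded_borel_def)

lemma bounded_borel_indicator [intro]: "A \<in> sets borel \<Longrightarrow> bounded_borel (indicator A)"
  by (rule bounded_borelI[where B=1]) (auto simp: indicator_def)

lemma bounded_borel_integrable [intro]:
  assumes "finite_measure M" "sets M = sets borel" "bounded_borel f"
  shows "integrable M f"
proof -
  interpret finite_measure M by fact
  obtain B where "\<And>x. \<bar>f x\<bar> \<le> B" using assms by (metis bounded_borel_def)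
  then show ?thesis
    using bounded_borel_measurable[OF assms(3)] measurable_cong_sets[OF assms(2) refl]
    by (intro integrable_const_bound[of _ B]) auto
qed

text \<open>The variance is nonnegative. The case of equality is what later forces limits to be
  constant.\<close>

lemma (in prob_space) abs_expectation_sq_le:
  assumes "integrable M f" "integrable M (\<lambda>x. (f x)\<^sup>2 :: real)"
  shows "(expectation f)\<^sup>2 \<le> expectation (\<lambda>x. (f x)\<^sup>2)"
  using variance_positive[of f] variance_eq[OF assms] by simp

section \<open>Reversible chains\<close>

text \<open>Exactly what the convergence proof uses of HMC. \<open>K_null\<close> exempts sets
  containing \<open>x\<close> because of the atom there; together with \<open>K_pos\<close> it makes
  \<open>K x\<close> equivalent to \<pi> off \<open>x\<close>. Stating reversibility for
  \<open>ennreal\<close> functions avoids integrability conditions, and \<open>t1_space\<close>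
  makes singletons Borel.\<close>

locale reversible_chain =
  fixes K :: "'a::t1_space \<Rightarrow> 'a measure" and \<pi> :: "'a measure"
  assumes K_measurable: "K \<in> borel \<rightarrow>\<^sub>M subprob_algebra borel"
    and K_prob: "\<And>x. prob_space (K x)"
    and pi_prob: "prob_space \<pi>"
    and sets_pi: "sets \<pi> = sets borel"
    and reversible: "\<And>f g :: 'a \<Rightarrow> ennreal. f \<in> borel_measurable borel \<Longrightarrow> g \<in> borel_measurable borel \<Longrightarrow>
      (\<integral>\<^sup>+x. f x * (\<integral>\<^sup>+y. g y \<partial>K x) \<partial>\<pi>) = (\<integral>\<^sup>+x. g x * (\<integral>\<^sup>+y. f y \<partial>K x) \<partial>\<pi>)"
    and K_null: "\<And>N x. N \<in> null_sets \<pi> \<Longrightarrow> x \<notin> N \<Longrightarrow> emeasure (K x) N = 0"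
    and K_pos: "\<And>A x. A \<in> sets borel \<Longrightarrow> emeasure \<pi> A > 0 \<Longrightarrow> emeasure (K x) A > 0"
    and pi_atomless: "\<And>x. emeasure \<pi> {x} = 0"
begin

sublocale pi: prob_space \<pi> by (rule pi_prob)
sublocale K: prob_space "K x" for x by (rule K_prob)

lemma sets_K: "sets (K x) = sets borel"
  using measurable_space[OF K_measurable, of x] by (simp add: space_subprob_algebra)

lemma space_K: "space (K x) = UNIV"
  using sets_eq_imp_space_eq[OF sets_K] by simp

lemma space_pi: "space \<pi> = UNIV"
  using sets_eq_imp_space_eq[OF sets_pi] by simp

lemmas measurable_sets_eq = measurable_cong_sets[OF sets_K refl] measurable_cong_sets[OF sets_pi refl]

lemma integrable_K: "bounded_borel f \<Longrightarrow> integrable (K x) f"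
  by (rule bounded_borel_integrable[OF K.finite_measure_axioms sets_K])

lemma integrable_pi: "bounded_borel f \<Longrightarrow> integrable \<pi> f"
  by (rule bounded_borel_integrable[OF pi.finite_measure_axioms sets_pi])

section \<open>The kernel as a self-adjoint operator on bounded functions\<close>

definition P :: "('a \<Rightarrow> real) \<Rightarrow> 'a \<Rightarrow> real" where
  "P f x = (\<integral>y. f y \<partial>K x)"

lemma P_measurable: "f \<in> borel_measurable borel \<Longrightarrow> P f \<in> borel_measurable borel"
  unfolding P_def using K_measurable
  by (intro measurable_compose[OF K_measurable] integral_measurable_subprob_algebra) auto

lemma P_bound:
  assumes "bounded_borel f" "\<And>x. \<bar>f x\<bar> \<le> B" shows "\<bar>P f x\<bar> \<le> B"
proof -
  have "\<bar>P f x\<bar> \<le> (\<integral>y. \<bar>f y\<bar> \<partial>K x)" unfolding P_def by (rule integral_abs_bound)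
  also have "\<dots> \<le> (\<integral>y. B \<partial>K x)"
    by (intro integral_mono integrable_K bounded_borel_abs assms bounded_borel_const)
  finally show ?thesis by (simp add: K.prob_space)
qed

lemma P_bounded_borel [intro]:
  assumes "bounded_borel f" shows "bounded_borel (P f)"
proof -
  obtain B where "\<And>x. \<bar>f x\<bar> \<le> B" using assms by (metis bounded_borel_def)
  then show ?thesis
    using P_bound[OF assms] P_measurable bounded_borel_measurable[OF assms] by (metis bounded_borelI)
qed

lemma P_add: "bounded_borel f \<Longrightarrow> bounded_borel g \<Longrightarrow> P (\<lambda>x. f x + g x) = (\<lambda>x. P f x + P g x)"
  by (auto simp: P_def integrable_K)

lemma P_diff: "bounded_borel f \<Longrightarrow> bounded_borel g \<Longrightarrow> P (\<lambda>x. f x - g x) = (\<lambda>x. P f x - P g x)"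
  by (auto simp: P_def integrable_K)

lemma P_const: "P (\<lambda>x. c) = (\<lambda>x. c)"
  by (auto simp: P_def K.prob_space)

lemma P_mono: "bounded_borel f \<Longrightarrow> bounded_borel g \<Longrightarrow> (\<And>x. f x \<le> g x) \<Longrightarrow> P f x \<le> P g x"
  unfolding P_def by (intro integral_mono integrable_K) auto

lemma P_self_adjoint_nonneg:
  assumes f: "bounded_borel f" "\<And>x. 0 \<le> f x" and g: "bounded_borel g" "\<And>x. 0 \<le> g x"
  shows "(\<integral>x. f x * P g x \<partial>\<pi>) = (\<integral>x. g x * P f x \<partial>\<pi>)"
proof -
  have *: "ennreal (\<integral>x. f x * P g x \<partial>\<pi>) = (\<integral>\<^sup>+x. ennreal (f x) * (\<integral>\<^sup>+y. ennreal (g y) \<partial>K x) \<partial>\<pi>)"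
    if f: "bounded_borel f" "\<And>x. 0 \<le> f x" and g: "bounded_borel g" "\<And>x. 0 \<le> g x" for f g
  proof -
    have P0: "0 \<le> P g x" for x unfolding P_def using g by simp
    have "(\<integral>\<^sup>+y. ennreal (g y) \<partial>K x) = ennreal (P g x)" for x
      unfolding P_def using g by (intro nn_integral_eq_integral integrable_K) auto
    then have "(\<integral>\<^sup>+x. ennreal (f x) * (\<integral>\<^sup>+y. ennreal (g y) \<partial>K x) \<partial>\<pi>) = (\<integral>\<^sup>+x. ennreal (f x * P g x) \<partial>\<pi>)"
      using f P0 by (simp add: ennreal_mult)
    also have "\<dots> = ennreal (\<integral>x. f x * P g x \<partial>\<pi>)"
      using f g P0 by (intro nn_integral_eq_integral integrable_pi) auto
    finally show ?thesis by simp
  qed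
  have "ennreal (\<integral>x. f x * P g x \<partial>\<pi>) = ennreal (\<integral>x. g x * P f x \<partial>\<pi>)"
    unfolding *[OF f g] *[OF g f]
    using bounded_borel_measurable[OF f(1)] bounded_borel_measurable[OF g(1)]
    by (intro reversible) auto
  moreover have "0 \<le> (\<integral>x. f x * P g x \<partial>\<pi>)" "0 \<le> (\<integral>x. g x * P f x \<partial>\<pi>)"
    using f g by (auto intro!: integral_nonneg mult_nonneg_nonneg simp: P_def)
  ultimately show ?thesis by simp
qed

lemma P_invariant_nonneg:
  assumes "bounded_borel f" "\<And>x. 0 \<le> f x"
  shows "(\<integral>x. P f x \<partial>\<pi>) = (\<integral>x. f x \<partial>\<pi>)"
  using P_self_adjoint_nonneg[OF bounded_borel_const[of 1] _ assms] by (simp add: P_const)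

text \<open>Adding the bounds \<open>B\<close> and \<open>C\<close> makes both functions
  nonnegative; the cross terms created in this way cancel because \<pi> is invariant.\<close>

lemma P_self_adjoint:
  assumes f: "bounded_borel f" and g: "bounded_borel g"
  shows "(\<integral>x. f x * P g x \<partial>\<pi>) = (\<integral>x. g x * P f x \<partial>\<pi>)"
proof -
  obtain B C where B: "\<And>x. \<bar>f x\<bar> \<le> B" and C: "\<And>x. \<bar>g x\<bar> \<le> C"
    using f g by (metis bounded_borel_def)
  have f0: "0 \<le> f x + B" for x using B[of x] by linarith
  have g0: "0 \<le> g x + C" for x using C[of x] by linarith
  have fB: "bounded_borel (\<lambda>x. f x + B)" and gC: "bounded_borel (\<lambda>x. g x + C)"
    using f g by auto
  have Pf: "P (\<lambda>x. f x + B) = (\<lambda>x. P f x + B)" "P (\<lambda>x. g x + C) = (\<lambda>x. P g x + C)"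
    using f g by (auto simp: P_add P_const)
  note I = integrable_pi[OF f] integrable_pi[OF g] integrable_pi[OF P_bounded_borel[OF f]]
    integrable_pi[OF P_bounded_borel[OF g]]
    integrable_pi[OF bounded_borel_mult[OF f P_bounded_borel[OF g]]]
    integrable_pi[OF bounded_borel_mult[OF g P_bounded_borel[OF f]]]
  have 1: "(\<integral>x. P f x \<partial>\<pi>) = (\<integral>x. f x \<partial>\<pi>)"
    using P_invariant_nonneg[OF fB f0] I by (simp add: Pf)
  have 2: "(\<integral>x. P g x \<partial>\<pi>) = (\<integral>x. g x \<partial>\<pi>)"
    using P_invariant_nonneg[OF gC g0] I by (simp add: Pf)
  have "(\<integral>x. (f x + B) * (P g x + C) \<partial>\<pi>) = (\<integral>x. (g x + C) * (P f x + B) \<partial>\<pi>)"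
    using P_self_adjoint_nonneg[OF fB f0 gC g0] by (simp add: Pf)
  then show ?thesis
    using I 1 2 by (simp add: distrib_left distrib_right pi.prob_space)
qed

lemma P_invariant:
  assumes "bounded_borel f" shows "(\<integral>x. P f x \<partial>\<pi>) = (\<integral>x. f x \<partial>\<pi>)"
  using P_self_adjoint[OF bounded_borel_const[of 1] assms] by (simp add: P_const)

lemma Pn_bounded_borel [intro]: "bounded_borel f \<Longrightarrow> bounded_borel ((P ^^ n) f)"
  by (induction n) auto

lemma Pn_bound: "bounded_borel f \<Longrightarrow> (\<And>x. \<bar>f x\<bar> \<le> B) \<Longrightarrow> \<bar>(P ^^ n) f x\<bar> \<le> B"
  by (induction n arbitrary: x) (auto intro!: P_bound)

lemma Pn_invariant: "bounded_borel f \<Longrightarrow> (\<integral>x. (P ^^ n) f x \<partial>\<pi>) = (\<integral>x. f x \<partial>\<pi>)"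
  by (induction n) (simp_all add: P_invariant Pn_bounded_borel)

lemma Pn_diff:
  "bounded_borel f \<Longrightarrow> bounded_borel g \<Longrightarrow> (P ^^ n) (\<lambda>x. f x - g x) = (\<lambda>x. (P ^^ n) f x - (P ^^ n) g x)"
  by (induction n) (simp_all add: P_diff Pn_bounded_borel)

lemma Pn_Pn: "(P ^^ m) ((P ^^ n) f) = (P ^^ (m + n)) f"
  by (simp add: funpow_add)

lemma Pn_const: "(P ^^ n) (\<lambda>x. c) = (\<lambda>x. c)"
  by (induction n) (auto simp: P_const)

lemma Pn_self_adjoint:
  assumes f: "bounded_borel f" and g: "bounded_borel g"
  shows "(\<integral>x. f x * (P ^^ n) g x \<partial>\<pi>) = (\<integral>x. (P ^^ n) f x * g x \<partial>\<pi>)"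
  using f
proof (induction n arbitrary: f)
  case (Suc n)
  have "(\<integral>x. f x * (P ^^ Suc n) g x \<partial>\<pi>) = (\<integral>x. (P ^^ n) g x * P f x \<partial>\<pi>)"
    using P_self_adjoint[of f "(P ^^ n) g"] Suc g by auto
  also have "\<dots> = (\<integral>x. P f x * (P ^^ n) g x \<partial>\<pi>)" by (simp add: mult.commute)
  also have "\<dots> = (\<integral>x. (P ^^ n) (P f) x * g x \<partial>\<pi>)" using Suc by auto
  finally show ?case by (simp add: funpow_swap1)
qed simp

lemma P_square_le:
  assumes "bounded_borel f" shows "(P f x)\<^sup>2 \<le> P (\<lambda>y. (f y)\<^sup>2) x"
  unfolding P_def using assms by (intro K.abs_expectation_sq_le integrable_K) auto

lemma P_L2_contraction:
  assumes "bounded_borel f" shows "(\<integral>x. (P f x)\<^sup>2 \<partial>\<pi>) \<le> (\<integral>x. (f x)\<^sup>2 \<partial>\<pi>)"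
proof -
  have "(\<integral>x. (P f x)\<^sup>2 \<partial>\<pi>) \<le> (\<integral>x. P (\<lambda>y. (f y)\<^sup>2) x \<partial>\<pi>)"
    using assms by (intro integral_mono integrable_pi P_square_le) auto
  also have "\<dots> = (\<integral>x. (f x)\<^sup>2 \<partial>\<pi>)" using assms by (intro P_invariant) auto
  finally show ?thesis .
qed

section \<open>Limits of the iterates in mean square\<close>

lemma Pn_L2_convergent:
  assumes f: "bounded_borel f"
  obtains c where "0 \<le> c" "(\<lambda>n. \<integral>x. ((P ^^ n) f x)\<^sup>2 \<partial>\<pi>) \<longlonglongrightarrow> c"
proof -
  have "decseq (\<lambda>n. \<integral>x. ((P ^^ n) f x)\<^sup>2 \<partial>\<pi>)"
    using P_L2_contraction[OF Pn_bounded_borel[OF f]] by (intro decseq_SucI) simp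
  moreover have "0 \<le> (\<integral>x. ((P ^^ n) f x)\<^sup>2 \<partial>\<pi>)" for n by simp
  ultimately obtain c where c: "(\<lambda>n. \<integral>x. ((P ^^ n) f x)\<^sup>2 \<partial>\<pi>) \<longlonglongrightarrow> c"
    using decseq_convergent by blast
  then have "0 \<le> c" by (rule LIMSEQ_le_const) simp
  then show ?thesis using c that by blast
qed

text \<open>Self-adjointness gives estimates in \<open>L\<^sup>2\<close>, while the extraction of an
  almost surely convergent subsequence and the duality with indicators take place in
  \<open>L\<^sup>1\<close>.\<close>

lemma L1_le_L2:
  assumes "bounded_borel f" shows "(\<integral>x. \<bar>f x\<bar> \<partial>\<pi>) \<le> sqrt (\<integral>x. (f x)\<^sup>2 \<partial>\<pi>)"
proof -
  have "(\<integral>x. \<bar>f x\<bar> \<partial>\<pi>)\<^sup>2 \<le> (\<integral>x. \<bar>f x\<bar>\<^sup>2 \<partial>\<pi>)"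
    using assms by (intro pi.abs_expectation_sq_le integrable_pi bounded_borel_power2 bounded_borel_abs)
  then show ?thesis by (simp add: real_le_rsqrt)
qed

text \<open>By self-adjointness, \<open>\<parallel>P\<^sup>2\<^sup>i f - P\<^sup>2\<^sup>j f\<parallel>\<^sup>2 = \<parallel>P\<^sup>2\<^sup>i f\<parallel>\<^sup>2 + \<parallel>P\<^sup>2\<^sup>j f\<parallel>\<^sup>2 - 2 \<parallel>P\<^sup>i\<^sup>+\<^sup>j f\<parallel>\<^sup>2\<close>.\<close>

lemma Pn_even_Cauchy_L1:
  assumes f: "bounded_borel f" and e: "0 < e"
  shows "\<exists>N. \<forall>i\<ge>N. \<forall>j\<ge>N. (\<integral>x. norm ((P ^^ (2 * i)) f x - (P ^^ (2 * j)) f x) \<partial>\<pi>) < e"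
proof -
  let ?a = "\<lambda>n. \<integral>x. ((P ^^ n) f x)\<^sup>2 \<partial>\<pi>"
  obtain c where c: "?a \<longlonglongrightarrow> c" using Pn_L2_convergent[OF f] by blast
  have "0 < e\<^sup>2 / 8" using e by simp
  then obtain N where N: "\<And>n. n \<ge> N \<Longrightarrow> \<bar>?a n - c\<bar> < e\<^sup>2 / 8"
    using LIMSEQ_D[OF c] by (metis real_norm_def)
  have "(\<integral>x. norm ((P ^^ (2 * i)) f x - (P ^^ (2 * j)) f x) \<partial>\<pi>) < e" if ij: "i \<ge> N" "j \<ge> N" for i j
  proof -
    let ?f = "\<lambda>n. (P ^^ n) f"
    note I = integrable_pi[OF bounded_borel_power2[OF Pn_bounded_borel[OF f]]]
      integrable_pi[OF bounded_borel_mult[OF Pn_bounded_borel[OF f] Pn_bounded_borel[OF f]]]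
    have "(\<integral>x. ?f (2 * i) x * ?f (2 * j) x \<partial>\<pi>) = ?a (i + j)"
    \<comment> \<open>Shifting the surplus powers of \<open>P\<close> from the higher iterate to the
      lower one makes both factors equal to \<open>?f (i + j)\<close>.\<close>
    proof (cases "i \<le> j")
      case True
      have "?f (2 * j) = (P ^^ (j - i)) (?f (i + j))"
        using True by (simp add: Pn_Pn mult_2)
      then have "(\<integral>x. ?f (2 * i) x * ?f (2 * j) x \<partial>\<pi>) = (\<integral>x. (P ^^ (j - i)) (?f (2 * i)) x * ?f (i + j) x \<partial>\<pi>)"
        using Pn_self_adjoint[OF Pn_bounded_borel[OF f] Pn_bounded_borel[OF f]] by simp
      also have "(P ^^ (j - i)) (?f (2 * i)) = ?f (i + j)"
        using True by (simp add: Pn_Pn)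
      finally show ?thesis by (simp add: power2_eq_square)
    next
      case False
      have "?f (2 * i) = (P ^^ (i - j)) (?f (i + j))"
        using False by (simp add: Pn_Pn mult_2)
      then have "(\<integral>x. ?f (2 * i) x * ?f (2 * j) x \<partial>\<pi>) = (\<integral>x. ?f (i + j) x * (P ^^ (i - j)) (?f (2 * j)) x \<partial>\<pi>)"
        using Pn_self_adjoint[OF Pn_bounded_borel[OF f] Pn_bounded_borel[OF f]] by simp
      also have "(P ^^ (i - j)) (?f (2 * j)) = ?f (i + j)"
        using False by (simp add: Pn_Pn add.commute)
      finally show ?thesis by (simp add: power2_eq_square)
    qed
    then have "(\<integral>x. (?f (2 * i) x - ?f (2 * j) x)\<^sup>2 \<partial>\<pi>) = ?a (2 * i) + ?a (2 * j) - 2 * ?a (i + j)"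
      using I by (simp add: power2_diff mult.assoc)
    also have "\<dots> < e\<^sup>2"
      using N[of "2 * i"] N[of "2 * j"] N[of "i + j"] ij by linarith
    finally have "sqrt (\<integral>x. (?f (2 * i) x - ?f (2 * j) x)\<^sup>2 \<partial>\<pi>) < e"
      using e by (simp add: real_less_lsqrt)
    then show ?thesis
      using L1_le_L2[OF bounded_borel_diff[OF Pn_bounded_borel[OF f] Pn_bounded_borel[OF f]], of "2 * i" "2 * j"]
      by simp
  qed
  then show ?thesis by blast
qed

lemma null_of_K_null:
  assumes "{y. Q y} \<in> sets borel" "AE y in K x. \<not> Q y" shows "AE y in \<pi>. \<not> Q y"
proof -
  have "emeasure (K x) {y. Q y} = 0"
    using assms AE_iff_measurable[of "{y. Q y}" "K x" "\<lambda>y. \<not> Q y"] by (simp add: sets_K space_K)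
  then have "emeasure \<pi> {y. Q y} = 0" using K_pos[OF assms(1), of x] by (auto simp: zero_less_iff_neq_zero)
  then show ?thesis
    using assms AE_iff_measurable[of "{y. Q y}" \<pi> "\<lambda>y. \<not> Q y"] by (simp add: sets_pi space_pi)
qed

text \<open>The premise \<open>Q x\<close> takes care of the possible atom of \<open>K x\<close> at
  \<open>x\<close>, which \<pi> does not see.\<close>

lemma K_AE_of_pi_AE:
  assumes "{y. \<not> Q y} \<in> sets borel" "AE y in \<pi>. Q y" "Q x" shows "AE y in K x. Q y"
proof -
  have "{y. \<not> Q y} \<in> null_sets \<pi>"
    using assms AE_iff_null[of \<pi> Q] by (simp add: sets_pi space_pi)
  then have "emeasure (K x) {y. \<not> Q y} = 0" using assms by (intro K_null) auto
  then show ?thesis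
    using assms AE_iff_measurable[of "{y. \<not> Q y}" "K x" Q] by (simp add: sets_K space_K)
qed

text \<open>An \<open>L\<^sup>2\<close> limit point \<open>g\<close> of \<open>P\<^sup>2\<^sup>n f\<close> satisfies \<open>\<parallel>P g\<parallel> = \<parallel>g\<parallel>\<close>, so for almost every \<open>x\<close>
  the variance of \<open>g\<close> under \<open>K x\<close> vanishes; as \<open>K x\<close> charges all sets charged by \<open>\<pi>\<close>, \<open>g\<close> is constant.\<close>

lemma Pn_L2_tendsto_0:
  assumes f: "bounded_borel f" and f0: "(\<integral>x. f x \<partial>\<pi>) = 0"
  shows "(\<lambda>n. \<integral>x. ((P ^^ n) f x)\<^sup>2 \<partial>\<pi>) \<longlonglongrightarrow> 0"
proof -
  obtain c where c: "(\<lambda>n. \<integral>x. ((P ^^ n) f x)\<^sup>2 \<partial>\<pi>) \<longlonglongrightarrow> c" using Pn_L2_convergent[OF f] by blast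
  obtain B where B0: "0 \<le> B" and B: "\<And>x. \<bar>f x\<bar> \<le> B" using bounded_borelE[OF f] by blast
  obtain r where r: "strict_mono r" and AEC: "AE x in \<pi>. Cauchy (\<lambda>i. (P ^^ (2 * r i)) f x)"
    using cauchy_L1_AE_cauchy_subseq[of \<pi> "\<lambda>i. (P ^^ (2 * i)) f"] Pn_even_Cauchy_L1[OF f]
      integrable_pi[OF Pn_bounded_borel[OF f]] by blast
  define s where "s i = (P ^^ (2 * r i)) f" for i
  have sb: "bounded_borel (s i)" for i unfolding s_def using f by (rule Pn_bounded_borel)
  have [measurable]: "s i \<in> borel_measurable borel" for i by (rule bounded_borel_measurable[OF sb])
  have sB: "\<bar>s i x\<bar> \<le> B" for i x unfolding s_def by (rule Pn_bound[OF f B])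
  define G where "G = {x. Cauchy (\<lambda>i. s i x)}"
  have G[measurable]: "G \<in> sets borel"
    unfolding G_def using sets_Collect_Cauchy[of s borel] by simp
  \<comment> \<open>The factor \<open>indicator G x\<close> makes the sequence converge everywhere,
    with limit 0 off \<open>G\<close>, so that \<open>g\<close> is Borel and bounded at every
    point.\<close>
  define g where "g x = lim (\<lambda>i. indicator G x * s i x)" for x
  have lim: "(\<lambda>i. s i x) \<longlonglongrightarrow> g x" if "x \<in> G" for x
    using that convergent_LIMSEQ_iff[of "\<lambda>i. s i x"] Cauchy_convergent[of "\<lambda>i. s i x"]
    by (simp add: g_def G_def)
  have g0: "g x = 0" if "x \<notin> G" for x using that by (simp add: g_def lim_const)
  have gm[measurable]: "g \<in> borel_measurable borel"
    unfolding g_def by (rule borel_measurable_lim_metric) measurable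
  have gB: "\<bar>g x\<bar> \<le> B" for x
  proof (cases "x \<in> G")
    case True
    show ?thesis
      by (rule LIMSEQ_le_const2[OF tendsto_rabs[OF lim[OF True]]]) (use sB in auto)
  qed (use g0 B0 in auto)
  have gb: "bounded_borel g" using gm gB by (rule bounded_borelI)
  have AEG: "AE x in \<pi>. x \<in> G" using AEC by (simp add: G_def s_def)
  \<comment> \<open>Restricted to \<open>G\<close>: if \<open>x\<close> itself were a point of
    divergence, the atom of \<open>K x\<close> could spoil the limit.\<close>
  have Plim: "(\<lambda>i. P (s i) x) \<longlonglongrightarrow> P g x" if x: "x \<in> G" for x
    unfolding P_def
  proof (rule integral_dominated_convergence[where w="\<lambda>_. B"])
    have "AE y in K x. y \<in> G" by (rule K_AE_of_pi_AE[OF _ AEG x]) (use G in simp)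
    then show "AE y in K x. (\<lambda>i. s i y) \<longlonglongrightarrow> g y" by eventually_elim (rule lim)
  qed (use sB in \<open>auto simp: measurable_sets_eq\<close>)
  have L2lim: "(\<lambda>i. \<integral>x. (u i x)\<^sup>2 \<partial>\<pi>) \<longlonglongrightarrow> (\<integral>x. (v x)\<^sup>2 \<partial>\<pi>)"
    if "\<And>i. bounded_borel (u i)" "bounded_borel v" "\<And>i x. \<bar>u i x\<bar> \<le> B" "\<And>x. x \<in> G \<Longrightarrow> (\<lambda>i. u i x) \<longlonglongrightarrow> v x"
    for u v
  proof (rule integral_dominated_convergence[where w="\<lambda>_. B\<^sup>2"])
    show "AE x in \<pi>. (\<lambda>i. (u i x)\<^sup>2) \<longlonglongrightarrow> (v x)\<^sup>2"
      using AEG by eventually_elim (intro tendsto_power that)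
    show "AE x in \<pi>. norm ((u i x)\<^sup>2) \<le> B\<^sup>2" for i
      using power_mono[OF that(3)[of i] abs_ge_zero, where n=2] by simp
  qed (use that(1,2)[THEN bounded_borel_measurable] in \<open>auto simp: measurable_sets_eq\<close>)
  have "(\<lambda>i. \<integral>x. (s i x)\<^sup>2 \<partial>\<pi>) \<longlonglongrightarrow> (\<integral>x. (g x)\<^sup>2 \<partial>\<pi>)"
    by (rule L2lim[OF sb gb sB lim])
  moreover have "(\<lambda>i. \<integral>x. (s i x)\<^sup>2 \<partial>\<pi>) \<longlonglongrightarrow> c"
    using LIMSEQ_subseq_LIMSEQ[OF c, of "\<lambda>i. 2 * r i"] r
    by (simp add: s_def strict_mono_def comp_def)
  ultimately have g2: "(\<integral>x. (g x)\<^sup>2 \<partial>\<pi>) = c" using LIMSEQ_unique by blast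
  have "(\<lambda>i. \<integral>x. (P (s i) x)\<^sup>2 \<partial>\<pi>) \<longlonglongrightarrow> (\<integral>x. (P g x)\<^sup>2 \<partial>\<pi>)"
    by (rule L2lim[OF P_bounded_borel[OF sb] P_bounded_borel[OF gb] P_bound[OF sb sB] Plim])
  \<comment> \<open>These are the odd iterates, whose norms have the same limit \<open>c\<close>.
    Hence \<open>P g\<close> and \<open>g\<close> have equal norm.\<close>
  moreover have "(\<lambda>i. \<integral>x. (P (s i) x)\<^sup>2 \<partial>\<pi>) \<longlonglongrightarrow> c"
    using LIMSEQ_subseq_LIMSEQ[OF c, of "\<lambda>i. Suc (2 * r i)"] r
    by (simp add: s_def strict_mono_def comp_def)
  ultimately have Pg2: "(\<integral>x. (P g x)\<^sup>2 \<partial>\<pi>) = c" using LIMSEQ_unique by blast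
  have "(\<lambda>i. \<integral>x. s i x \<partial>\<pi>) \<longlonglongrightarrow> (\<integral>x. g x \<partial>\<pi>)"
  proof (rule integral_dominated_convergence[where w="\<lambda>_. B"])
    show "AE x in \<pi>. (\<lambda>i. s i x) \<longlonglongrightarrow> g x" using AEG by eventually_elim (rule lim)
  qed (use sB in \<open>auto simp: measurable_sets_eq\<close>)
  then have Eg: "(\<integral>x. g x \<partial>\<pi>) = 0"
    by (simp add: s_def Pn_invariant[OF f] f0 LIMSEQ_const_iff)
  let ?V = "\<lambda>x. P (\<lambda>y. (g y)\<^sup>2) x - (P g x)\<^sup>2"
  have Vb: "bounded_borel ?V"
    by (intro bounded_borel_diff bounded_borel_power2 P_bounded_borel gb)
  have "(\<integral>x. ?V x \<partial>\<pi>) = 0"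
    using integrable_pi[OF P_bounded_borel[OF bounded_borel_power2[OF gb]]]
      integrable_pi[OF bounded_borel_power2[OF P_bounded_borel[OF gb]]]
    by (simp add: P_invariant[OF bounded_borel_power2[OF gb]] g2 Pg2)
  then have "AE x in \<pi>. ?V x = 0"
    using integral_nonneg_eq_0_iff_AE[OF integrable_pi[OF Vb]] P_square_le[OF gb] by simp
  \<comment> \<open>One point of zero variance suffices: \<open>g\<close> is constant
    \<open>K x\<close>-almost everywhere, and null sets of \<open>K x\<close> are null for
    \<pi>.\<close>
  then obtain x where x: "?V x = 0"
    using eventually_happens[of "\<lambda>x. ?V x = 0" "ae_filter \<pi>"] pi.ae_filter_bot by auto
  define m where "m = P g x"
  have "(\<integral>y. (g y - m)\<^sup>2 \<partial>K x) = P (\<lambda>y. (g y)\<^sup>2) x - 2 * m * P g x + m\<^sup>2"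
    using integrable_K[OF gb] integrable_K[OF bounded_borel_power2[OF gb]]
    by (simp add: power2_diff P_def K.prob_space algebra_simps)
  also have "\<dots> = 0" using x by (simp add: m_def power2_eq_square)
  finally have "AE y in K x. (g y - m)\<^sup>2 = 0"
    using integral_nonneg_eq_0_iff_AE[OF integrable_K[OF bounded_borel_power2[OF
          bounded_borel_diff[OF gb bounded_borel_const]]]] by simp
  then have "AE y in K x. \<not> (g y \<noteq> m)" by simp
  then have "AE y in \<pi>. \<not> (g y \<noteq> m)" by (rule null_of_K_null[rotated]) measurable
  then have gm': "AE y in \<pi>. g y = m" by simp
  then have "(\<integral>x. g x \<partial>\<pi>) = (\<integral>x. m \<partial>\<pi>)" by (intro integral_cong_AE) (auto simp: measurable_sets_eq)
  then have "m = 0" using Eg by (simp add: pi.prob_space)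
  then have "(\<integral>x. (g x)\<^sup>2 \<partial>\<pi>) = (\<integral>x. 0 \<partial>\<pi>)"
    using gm' by (intro integral_cong_AE) (auto simp: measurable_sets_eq)
  then show ?thesis using c g2 by simp
qed

lemma Pn_L1_tendsto_0:
  assumes f: "bounded_borel f" and f0: "(\<integral>x. f x \<partial>\<pi>) = 0"
  shows "(\<lambda>n. \<integral>x. \<bar>(P ^^ n) f x\<bar> \<partial>\<pi>) \<longlonglongrightarrow> 0"
proof (rule tendsto_sandwich[OF _ _ tendsto_const])
  show "(\<lambda>n. sqrt (\<integral>x. ((P ^^ n) f x)\<^sup>2 \<partial>\<pi>)) \<longlonglongrightarrow> 0"
    using tendsto_real_sqrt[OF Pn_L2_tendsto_0[OF assms]] by simp
qed (use L1_le_L2[OF Pn_bounded_borel[OF f]] in auto)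

text \<open>Self-adjointness moves \<open>P ^^ n\<close> from the indicator to the density, where
  the estimate no longer involves \<open>A\<close>; this is the source of uniformity. As
  \<open>f\<close> may be unbounded, it is first truncated at a level \<open>k\<close> that costs
  less than \<open>e / 2\<close> in \<open>L\<^sup>1\<close>.\<close>

lemma density_uniform_tendsto:
  fixes f :: "'a \<Rightarrow> real"
  assumes f0: "\<And>x. 0 \<le> f x" and fi: "integrable \<pi> f" and e: "0 < e"
  shows "\<exists>N. \<forall>n\<ge>N. \<forall>A\<in>sets borel. \<bar>\<integral>x. f x * ((P ^^ n) (indicator A) x - measure \<pi> A) \<partial>\<pi>\<bar> < e"
proof -
  have fm[measurable]: "f \<in> borel_measurable borel"
    using borel_measurable_integrable[OF fi] by (simp add: measurable_sets_eq)
  have "(\<lambda>k::nat. \<integral>x. min (f x) (real k) \<partial>\<pi>) \<longlonglongrightarrow> (\<integral>x. f x \<partial>\<pi>)"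
  proof (rule integral_dominated_convergence[OF _ _ fi])
    show "AE x in \<pi>. (\<lambda>k::nat. min (f x) (real k)) \<longlonglongrightarrow> f x"
    proof (rule AE_I2)
      fix x
      obtain k0 :: nat where "f x \<le> real k0" using real_arch_simple by blast
      then show "(\<lambda>k::nat. min (f x) (real k)) \<longlonglongrightarrow> f x"
        by (intro tendsto_eventually) (auto simp: eventually_sequentially intro!: exI[of _ k0])
    qed
  qed (use f0 in \<open>auto simp: measurable_sets_eq\<close>)
  moreover have "0 < e / 2" using e by simp
  ultimately obtain k :: nat where k: "\<bar>(\<integral>x. min (f x) (real k) \<partial>\<pi>) - (\<integral>x. f x \<partial>\<pi>)\<bar> < e / 2"
    using LIMSEQ_D[of _ "\<integral>x. f x \<partial>\<pi>" "e / 2"] by (metis real_norm_def order_refl)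
  define fk where "fk x = min (f x) (real k)" for x
  have fkb: "bounded_borel fk"
    unfolding fk_def using f0 by (intro bounded_borelI[where B="real k"]) auto
  define m where "m = (\<integral>x. fk x \<partial>\<pi>)"
  have "(\<lambda>n. \<integral>x. \<bar>(P ^^ n) (\<lambda>x. fk x - m) x\<bar> \<partial>\<pi>) \<longlonglongrightarrow> 0"
    using fkb integrable_pi[OF fkb] by (intro Pn_L1_tendsto_0) (auto simp: m_def pi.prob_space)
  then obtain N where N: "\<And>n. n \<ge> N \<Longrightarrow> (\<integral>x. \<bar>(P ^^ n) (\<lambda>x. fk x - m) x\<bar> \<partial>\<pi>) < e / 2"
    using LIMSEQ_D[of _ 0 "e / 2"] \<open>0 < e / 2\<close> by fastforce
  have "\<bar>\<integral>x. f x * ((P ^^ n) (indicator A) x - measure \<pi> A) \<partial>\<pi>\<bar> < e"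
    if n: "n \<ge> N" and A: "A \<in> sets borel" for n A
  proof -
    define a where "a x = indicator A x - measure \<pi> A" for x :: 'a
    have iA: "bounded_borel (indicator A :: 'a \<Rightarrow> real)" using A by auto
    have ab: "bounded_borel a" unfolding a_def using iA by auto
    have aB: "\<bar>a x\<bar> \<le> 1" for x
      using pi.prob_le_1[of A] measure_nonneg[of \<pi> A] by (auto simp: a_def indicator_def)
    have Ea: "(\<integral>x. a x \<partial>\<pi>) = 0"
      using integrable_pi[OF iA] A pi.prob_space by (simp add: a_def sets_pi space_pi)
    have Pa: "(P ^^ n) (indicator A) x - measure \<pi> A = (P ^^ n) a x" for x
      unfolding a_def using Pn_diff[OF iA bounded_borel_const, of n "measure \<pi> A"] by (simp add: Pn_const)
    have Pab: "bounded_borel ((P ^^ n) a)" using ab by auto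
    have Pnb: "bounded_borel ((P ^^ n) (\<lambda>x. fk x - m))"
      by (rule Pn_bounded_borel[OF bounded_borel_diff[OF fkb bounded_borel_const]])
    have int: "integrable \<pi> (\<lambda>x. f x * (P ^^ n) a x)"
    proof (rule Bochner_Integration.integrable_bound[OF fi])
      show "AE x in \<pi>. norm (f x * (P ^^ n) a x) \<le> norm (f x)"
        using Pn_bound[OF ab aB, of n] f0 by (simp add: abs_mult mult_left_le)
    qed (use bounded_borel_measurable[OF Pab] in \<open>simp add: measurable_sets_eq\<close>)
    have "\<bar>\<integral>x. f x * (P ^^ n) a x - fk x * (P ^^ n) a x \<partial>\<pi>\<bar> \<le> (\<integral>x. f x - fk x \<partial>\<pi>)"
    proof (rule order_trans[OF integral_abs_bound integral_mono])
      show "\<bar>f x * (P ^^ n) a x - fk x * (P ^^ n) a x\<bar> \<le> f x - fk x" for x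
      proof -
        have "\<bar>f x * (P ^^ n) a x - fk x * (P ^^ n) a x\<bar> = (f x - fk x) * \<bar>(P ^^ n) a x\<bar>"
          by (simp add: left_diff_distrib[symmetric] abs_mult fk_def)
        also have "\<dots> \<le> f x - fk x"
          using Pn_bound[OF ab aB, of n x] by (intro mult_left_le) (auto simp: fk_def)
        finally show ?thesis .
      qed
    qed (use int fi integrable_pi[OF fkb] integrable_pi[OF bounded_borel_mult[OF fkb Pab]] in auto)
    also have "\<dots> < e / 2"
      using k unfolding fk_def[symmetric] Bochner_Integration.integral_diff[OF fi integrable_pi[OF fkb]]
      by linarith
    finally have 1: "\<bar>(\<integral>x. f x * (P ^^ n) a x \<partial>\<pi>) - (\<integral>x. fk x * (P ^^ n) a x \<partial>\<pi>)\<bar> < e / 2"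
      using int integrable_pi[OF bounded_borel_mult[OF fkb Pab]] by simp
    have "(\<integral>x. fk x * (P ^^ n) a x \<partial>\<pi>) = (\<integral>x. (P ^^ n) fk x * a x \<partial>\<pi>)"
      by (rule Pn_self_adjoint[OF fkb ab])
    \<comment> \<open>Centring \<open>fk\<close> is free since \<open>a\<close> has mean zero, and
      it makes \<open>Pn_L1_tendsto_0\<close> applicable.\<close>
    also have "\<dots> = (\<integral>x. (P ^^ n) (\<lambda>x. fk x - m) x * a x \<partial>\<pi>)"
      using integrable_pi[OF bounded_borel_mult[OF Pn_bounded_borel[OF fkb] ab]] integrable_pi[OF ab] Ea
      by (simp add: Pn_diff[OF fkb bounded_borel_const] Pn_const left_diff_distrib)
    also have "\<bar>\<dots>\<bar> \<le> (\<integral>x. \<bar>(P ^^ n) (\<lambda>x. fk x - m) x\<bar> \<partial>\<pi>)"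
      using aB by (intro order_trans[OF integral_abs_bound integral_mono] integrable_pi
          bounded_borel_abs bounded_borel_mult Pnb ab) (simp add: abs_mult mult_left_le)
    also have "\<dots> < e / 2" by (rule N[OF n])
    finally have "\<bar>\<integral>x. fk x * (P ^^ n) a x \<partial>\<pi>\<bar> < e / 2" .
    with 1 show ?thesis unfolding Pa by linarith
  qed
  then show ?thesis by blast
qed

section \<open>Convergence from a single starting point\<close>

lemma pi_UNIV: "measure \<pi> UNIV = 1" "emeasure \<pi> UNIV = 1"
  using pi.prob_space pi.emeasure_space_1 by (simp_all add: space_pi)

text \<open>A point is null for \<pi>, so its complement has positive measure and is charged by
  \<open>K x\<close>.\<close>

lemma K_singleton_less_1: "measure (K x) {x} < 1"
proof -
  have "emeasure \<pi> (- {x}) = 1"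
    using pi.prob_compl[of "{x}"] pi_atomless[of x]
    by (simp add: sets_pi space_pi Compl_eq_Diff_UNIV pi.emeasure_eq_measure)
  then have "0 < emeasure (K x) (- {x})" by (intro K_pos) auto
  then have "0 < measure (K x) (- {x})" by (simp add: K.emeasure_eq_measure)
  moreover have "measure (K x) (- {x}) = 1 - measure (K x) {x}"
    using K.prob_compl[where x=x and A="{x}"] by (simp add: sets_K space_K Compl_eq_Diff_UNIV)
  ultimately show ?thesis by simp
qed

text \<open>Off \<open>x\<close> the measure \<open>K x\<close> is absolutely continuous by
  \<open>K_null\<close>, and \<open>f\<close> is its Radon-Nikodym density.\<close>

lemma K_decomposition:
  obtains f :: "'a \<Rightarrow> real" where "\<And>y. 0 \<le> f y" "integrable \<pi> f"
    "\<And>g. bounded_borel g \<Longrightarrow> P g x = measure (K x) {x} * g x + (\<integral>y. f y * g y \<partial>\<pi>)"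
proof -
  define \<nu> where "\<nu> = density (K x) (\<lambda>y. ennreal (indicator (- {x}) y))"
  have sets_\<nu>: "sets \<nu> = sets borel" by (simp add: \<nu>_def sets_K)
  have em\<nu>: "emeasure \<nu> A = emeasure (K x) (A - {x})" if "A \<in> sets borel" for A
  proof -
    have "emeasure \<nu> A = (\<integral>\<^sup>+y. indicator (A - {x}) y \<partial>K x)"
      unfolding \<nu>_def using that
      by (subst emeasure_density)
        (auto simp: sets_K measurable_sets_eq simp del: nn_integral_indicator intro!: nn_integral_cong
          split: split_indicator)
    then show ?thesis using that by (simp add: sets_K)
  qed
  have "absolutely_continuous \<pi> \<nu>"
    unfolding absolutely_continuous_def
  proof safe
    fix N assume N: "N \<in> null_sets \<pi>"
    then have "N - {x} \<in> null_sets \<pi>" by (rule null_sets_subset) (use N in \<open>auto simp: sets_pi\<close>)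
    then have "emeasure (K x) (N - {x}) = 0" by (rule K_null) simp
    with N show "N \<in> null_sets \<nu>" by (auto simp: null_sets_def sets_\<nu> sets_pi em\<nu>)
  qed
  then obtain F where F: "F \<in> borel_measurable \<pi>" "density \<pi> F = \<nu>"
    using pi.Radon_Nikodym[of \<nu>] by (auto simp: sets_\<nu> sets_pi)
  have "(\<integral>\<^sup>+y. F y \<partial>\<pi>) = emeasure \<nu> UNIV"
    using F(1) by (simp add: F(2)[symmetric] emeasure_density sets_pi space_pi cong: nn_integral_cong)
  also have "\<dots> \<le> 1" using K.emeasure_le_1 by (simp add: em\<nu>)
  finally have Ffin: "(\<integral>\<^sup>+y. F y \<partial>\<pi>) \<noteq> \<infinity>" by (auto simp: top_unique)
  \<comment> \<open>\<open>F\<close> has integral at most 1, hence is finite almost everywhere, and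
    \<open>enn2real\<close> changes it on a null set only.\<close>
  define f where "f y = enn2real (F y)" for y
  have fm: "f \<in> borel_measurable \<pi>" unfolding f_def using F(1) by measurable
  have AEF: "AE y in \<pi>. F y = ennreal (f y)"
    using nn_integral_PInf_AE[OF F(1) Ffin] by eventually_elim (simp add: f_def top.not_eq_extremum)
  have f\<nu>: "density \<pi> f = \<nu>"
    unfolding F(2)[symmetric] using AEF F(1) fm by (intro density_cong) auto
  have "(\<integral>\<^sup>+y. ennreal (f y) \<partial>\<pi>) = (\<integral>\<^sup>+y. F y \<partial>\<pi>)"
    using AEF by (intro nn_integral_cong_AE) auto
  then have fi: "integrable \<pi> f"
    using Ffin fm by (intro integrableI_nonneg) (auto simp: f_def top.not_eq_extremum)
  have "P g x = measure (K x) {x} * g x + (\<integral>y. f y * g y \<partial>\<pi>)" if g: "bounded_borel g" for g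
  proof -
    have gm: "g \<in> borel_measurable borel" using g by (rule bounded_borel_measurable)
    have ib: "bounded_borel (\<lambda>y. indicator {x} y * g x)" "bounded_borel (\<lambda>y. indicator (- {x}) y * g y)"
      using g by (auto intro!: bounded_borel_mult bounded_borel_indicator)
    have "P g x = (\<integral>y. indicator {x} y * g x + indicator (- {x}) y * g y \<partial>K x)"
      unfolding P_def by (intro Bochner_Integration.integral_cong) (auto split: split_indicator)
    also have "\<dots> = measure (K x) {x} * g x + (\<integral>y. indicator (- {x}) y * g y \<partial>K x)"
      using integrable_K[OF ib(1)] integrable_K[OF ib(2)] by (simp add: sets_K space_K)
    also have "(\<integral>y. indicator (- {x}) y * g y \<partial>K x) = (\<integral>y. g y \<partial>\<nu>)"
      unfolding \<nu>_def using gm by (subst integral_density) (auto simp: measurable_sets_eq sets_K)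
    also have "\<dots> = (\<integral>y. f y * g y \<partial>\<pi>)"
      unfolding f\<nu>[symmetric] using gm fm
      by (subst integral_density) (auto simp: measurable_sets_eq f_def)
    finally show ?thesis .
  qed
  with fi show ?thesis by (intro that[of f]) (auto simp: f_def)
qed

lemma kpow_measurable: "kpow K n \<in> borel \<rightarrow>\<^sub>M subprob_algebra borel"
proof (induction n)
  case (Suc n)
  then show ?case using measurable_bind2[OF K_measurable Suc] by (simp cong: measurable_cong)
qed simp

lemma sets_kpow: "sets (kpow K n x) = sets borel"
  using measurable_space[OF kpow_measurable, of x n] by (simp add: space_subprob_algebra)

lemma prob_space_kpow: "prob_space (kpow K n x)"
proof (induction n arbitrary: x)
  case (Suc n)
  have "prob_space (K x \<bind> kpow K n)"
    by (rule K.prob_space_bind[where S=borel])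
      (use Suc kpow_measurable in \<open>auto simp: measurable_sets_eq\<close>)
  then show ?case by simp
qed (simp add: prob_space_return)

text \<open>Both recursions split off the first step of the chain: \<open>kpow\<close> through
  \<open>\<bind>\<close>, and \<open>P ^^ n\<close> through its outermost \<open>P\<close>.\<close>

lemma measure_kpow:
  assumes A: "A \<in> sets borel" shows "measure (kpow K n x) A = (P ^^ n) (indicator A) x"
proof (induction n arbitrary: x)
  case 0
  then show ?case using A by (simp add: measure_def emeasure_return split: split_indicator)
next
  case (Suc n)
  have "measure (kpow K (Suc n) x) A = (\<integral>y. measure (kpow K n y) A \<partial>K x)"
    using K.measure_bind[of "kpow K n" x borel A] kpow_measurable A
    by (simp add: measurable_sets_eq)
  then show ?case by (simp add: Suc P_def)
qed

text \<open>Conditioning on the first step gives a recursion for the error: with weight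
  \<open>r\<close> the chain is still at \<open>x\<close> with one step less to go, and otherwise it
  starts from the density \<open>f\<close>, where convergence is already uniform in
  \<open>A\<close>.\<close>

lemma kpow_uniform_tendsto:
  assumes e: "0 < e"
  shows "\<exists>N. \<forall>n\<ge>N. \<forall>A\<in>sets borel. \<bar>measure (kpow K n x) A - measure \<pi> A\<bar> < e"
proof -
  define r where "r = measure (K x) {x}"
  have r: "0 \<le> r" "r < 1" using K_singleton_less_1 by (auto simp: r_def)
  obtain f :: "'a \<Rightarrow> real" where f0: "\<And>y. 0 \<le> f y" and fi: "integrable \<pi> f"
    and f: "\<And>g. bounded_borel g \<Longrightarrow> P g x = r * g x + (\<integral>y. f y * g y \<partial>\<pi>)"
    using K_decomposition[of x] unfolding r_def by blast
  \<comment> \<open>With this tolerance \<open>e / 2\<close> is the fixed point of the recursion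
    with factor \<open>r\<close>, which leaves the error \<open>r ^ n + e / 2\<close>.\<close>
  have "0 < (1 - r) * (e / 2)" using r e by simp
  from density_uniform_tendsto[OF f0 fi this]
  obtain N where N: "\<And>n A. n \<ge> N \<Longrightarrow> A \<in> sets borel \<Longrightarrow>
      \<bar>\<integral>y. f y * ((P ^^ n) (indicator A) y - measure \<pi> A) \<partial>\<pi>\<bar> < (1 - r) * (e / 2)" by blast
  have step: "\<bar>measure (kpow K (N + n) x) A - measure \<pi> A\<bar> \<le> r ^ n + e / 2" if A: "A \<in> sets borel" for n A
  proof (induction n)
    case 0
    interpret k: prob_space "kpow K N x" by (rule prob_space_kpow)
    show ?case
      using k.prob_le_1[of A] measure_nonneg[of "kpow K N x" A] pi.prob_le_1[of A]
        measure_nonneg[of \<pi> A] e unfolding add_0_right power_0 by linarith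
  next
    case (Suc n)
    define d where "d y = (P ^^ (N + n)) (indicator A) y - measure \<pi> A" for y
    have Ab: "bounded_borel ((P ^^ (N + n)) (indicator A))" using A by auto
    have db: "bounded_borel d"
      unfolding d_def by (rule bounded_borel_diff[OF Ab bounded_borel_const])
    have "measure (kpow K (N + Suc n) x) A - measure \<pi> A = P d x"
      unfolding d_def P_diff[OF Ab bounded_borel_const] P_const using A
      by (simp only: measure_kpow[OF A] add_Suc_right funpow.simps comp_def)
    also have "\<dots> = r * d x + (\<integral>y. f y * d y \<partial>\<pi>)" by (rule f[OF db])
    finally have "\<bar>measure (kpow K (N + Suc n) x) A - measure \<pi> A\<bar> \<le> r * \<bar>d x\<bar> + \<bar>\<integral>y. f y * d y \<partial>\<pi>\<bar>"
      using r by (simp add: abs_mult abs_triangle_ineq[THEN order_trans])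
    also have "\<dots> \<le> r * (r ^ n + e / 2) + (1 - r) * (e / 2)"
      using Suc N[of "N + n" A] A r
      by (intro add_mono mult_left_mono) (auto simp: d_def measure_kpow[OF A])
    also have "\<dots> = r ^ Suc n + e / 2" by (simp add: field_simps)
    finally show ?case .
  qed
  obtain M where M: "\<And>n. n \<ge> M \<Longrightarrow> r ^ n < e / 2"
    using LIMSEQ_D[OF LIMSEQ_power_zero, of r "e / 2"] r e by auto
  have "\<bar>measure (kpow K n x) A - measure \<pi> A\<bar> < e" if n: "n \<ge> N + M" and A: "A \<in> sets borel" for n A
  proof -
    have "M \<le> n - N" "N + (n - N) = n" using n by auto
    then show ?thesis using step[OF A, of "n - N"] M[of "n - N"] by simp
  qed
  then show ?thesis by blast
qed

end

text \<open>Group the cells of a partition by the sign of the difference of the measures. Each group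
  contributes the difference on one event, the union of its cells, hence at most
  \<open>e\<close>.\<close>

lemma tv_norm_le:
  fixes \<mu> \<nu> :: "'b::topological_space measure"
  assumes "finite_measure \<mu>" "finite_measure \<nu>" "sets \<mu> = sets borel" "sets \<nu> = sets borel"
    and e: "\<And>A. A \<in> sets borel \<Longrightarrow> \<bar>measure \<mu> A - measure \<nu> A\<bar> \<le> e"
  shows "0 \<le> tv_norm \<mu> \<nu>" "tv_norm \<mu> \<nu> \<le> 2 * e"
proof -
  interpret m: finite_measure \<mu> by fact
  interpret n: finite_measure \<nu> by fact
  define X where "X = {(n::nat, A::nat \<Rightarrow> 'b set). (\<forall>i<n. A i \<in> sets borel) \<and> disjoint_family_on A {..<n}
                                  \<and> (\<Union>i<n. A i) = UNIV}"
  define F where "F PA = (\<Sum>i < fst PA. \<bar>measure \<mu> (snd PA i) - measure \<nu> (snd PA i)\<bar>)" for PA :: "nat \<times> (nat \<Rightarrow> 'b set)"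
  have tv: "tv_norm \<mu> \<nu> = (SUP PA\<in>X. F PA)" by (simp add: tv_norm_def X_def F_def)
  have F_le: "F PA \<le> 2 * e" if "PA \<in> X" for PA
  proof -
    obtain n A where PA: "PA = (n, A)" by (cases PA)
    with that have A: "\<And>i. i < n \<Longrightarrow> A i \<in> sets borel" and disj: "disjoint_family_on A {..<n}"
      by (auto simp: X_def)
    define S where "S = {i. i < n \<and> measure \<nu> (A i) \<le> measure \<mu> (A i)}"
    have un: "measure \<mu> (\<Union>i\<in>I. A i) - measure \<nu> (\<Union>i\<in>I. A i) = (\<Sum>i\<in>I. measure \<mu> (A i) - measure \<nu> (A i))"
      if "I \<subseteq> {..<n}" for I
    proof -
      have "finite I" "disjoint_family_on A I" "A ` I \<subseteq> sets borel"
        using that A finite_subset[OF that] disjoint_family_on_mono[OF that disj] by auto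
      then show ?thesis
        using assms by (simp add: m.finite_measure_finite_Union n.finite_measure_finite_Union sum_subtractf)
    qed
    have "F PA = (\<Sum>i\<in>S. \<bar>measure \<mu> (A i) - measure \<nu> (A i)\<bar>) + (\<Sum>i\<in>{..<n} - S. \<bar>measure \<mu> (A i) - measure \<nu> (A i)\<bar>)"
      unfolding F_def PA fst_conv snd_conv by (rule sum.subset_diff[of S, THEN trans]) (auto simp: S_def)
    also have "\<dots> = (\<Sum>i\<in>S. measure \<mu> (A i) - measure \<nu> (A i)) - (\<Sum>i\<in>{..<n} - S. measure \<mu> (A i) - measure \<nu> (A i))"
      unfolding sum_negf[symmetric] diff_conv_add_uminus
      by (intro arg_cong2[where f="(+)"] sum.cong) (auto simp: S_def)
    also have "\<dots> = (measure \<mu> (\<Union>i\<in>S. A i) - measure \<nu> (\<Union>i\<in>S. A i))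
        - (measure \<mu> (\<Union>i\<in>{..<n} - S. A i) - measure \<nu> (\<Union>i\<in>{..<n} - S. A i))"
      by (subst (1 2) un) (auto simp: S_def)
    also have "\<dots> \<le> e + e"
      using e[of "\<Union>i\<in>S. A i"] e[of "\<Union>i\<in>{..<n} - S. A i"] A
      by (auto simp: S_def abs_le_iff intro!: sets.finite_UN)
    finally show ?thesis by simp
  qed
  \<comment> \<open>The trivial partition shows that the supremum is over a nonempty set and is
    nonnegative.\<close>
  have one: "(1, \<lambda>_. UNIV) \<in> X" by (auto simp: X_def disjoint_family_on_def)
  have "0 \<le> F (1, \<lambda>_. UNIV)" by (simp add: F_def)
  also have "\<dots> \<le> tv_norm \<mu> \<nu>"
    unfolding tv by (rule cSUP_upper[OF one]) (use F_le in \<open>auto intro!: bdd_aboveI2\<close>)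
  finally show "0 \<le> tv_norm \<mu> \<nu>" .
  show "tv_norm \<mu> \<nu> \<le> 2 * e"
    unfolding tv by (rule cSUP_least) (use one F_le in auto)
qed

context reversible_chain begin

theorem tv_norm_kpow_tendsto_0: "(\<lambda>n. tv_norm (kpow K n x) \<pi>) \<longlonglongrightarrow> 0"
proof (rule LIMSEQ_I)
  fix e :: real assume "0 < e"
  then obtain N where N: "\<And>n A. n \<ge> N \<Longrightarrow> A \<in> sets borel \<Longrightarrow> \<bar>measure (kpow K n x) A - measure \<pi> A\<bar> < e / 4"
    using kpow_uniform_tendsto[of "e / 4" x] by auto
  have "norm (tv_norm (kpow K n x) \<pi> - 0) < e" if "n \<ge> N" for n
    using tv_norm_le[of "kpow K n x" \<pi> "e / 4"] N[OF that, THEN less_imp_le] \<open>0 < e\<close>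
      prob_space.finite_measure[OF prob_space_kpow, of n x] pi.finite_measure_axioms
    by (simp add: sets_kpow sets_pi)
  then show "\<exists>N. \<forall>n\<ge>N. norm (tv_norm (kpow K n x) \<pi> - 0) < e" by blast
qed

end

section \<open>Avoiding a set along the path, and Harris recurrence\<close>

lemma measurable_component_compose:
  "h \<in> borel \<rightarrow>\<^sub>M L \<Longrightarrow> i \<in> I \<Longrightarrow> (\<lambda>\<omega>. h (\<omega> i)) \<in> PiM I (\<lambda>_. borel) \<rightarrow>\<^sub>M L"
  by (rule measurable_compose[where f="\<lambda>\<omega>. \<omega> i" and N=borel])
    (auto intro: measurable_component_singleton[where M="\<lambda>_. borel"])

lemma sets_Collect_avoids:
  assumes "A \<in> sets borel" "finite S" "S \<subseteq> J"
  shows "{\<omega> \<in> space (PiM J (\<lambda>_. borel)). \<forall>m\<in>S. \<omega> m \<notin> A} \<in> sets (PiM J (\<lambda>_. borel))"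
proof (intro sets.sets_Collect_finite_All assms(2))
  fix m assume "m \<in> S"
  then have "(\<lambda>\<omega>. \<omega> m) \<in> PiM J (\<lambda>_. borel) \<rightarrow>\<^sub>M borel"
    using measurable_component_compose[OF measurable_ident] assms(3) by auto
  from measurable_sets[OF this, of "- A"] assms(1)
  show "{\<omega> \<in> space (PiM J (\<lambda>_. borel)). \<omega> m \<notin> A} \<in> sets (PiM J (\<lambda>_. borel))"
    by (auto simp: vimage_def Int_def conj_commute)
qed

context reversible_chain begin

text \<open>\<open>taboo A j x\<close> is the probability that the chain started at \<open>x\<close> avoids \<open>A\<close> at times \<open>1, ..., j\<close>.\<close>

definition taboo :: "'a set \<Rightarrow> nat \<Rightarrow> 'a \<Rightarrow> real" where
  "taboo A j = ((\<lambda>u. P (\<lambda>y. indicator (- A) y * u y)) ^^ j) (\<lambda>_. 1)"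

lemma taboo_Suc: "taboo A (Suc j) = P (\<lambda>y. indicator (- A) y * taboo A j y)"
  by (simp add: taboo_def)

lemma taboo_bounded_borel:
  assumes "A \<in> sets borel" shows "bounded_borel (taboo A j)"
proof (induction j)
  case (Suc j)
  show ?case
    unfolding taboo_Suc
    by (rule P_bounded_borel[OF bounded_borel_mult[OF bounded_borel_indicator Suc]])
      (use assms in auto)
qed (simp add: taboo_def)

lemma taboo_nonneg: "0 \<le> taboo A j x"
proof (induction j arbitrary: x)
  case (Suc j)
  then show ?case unfolding taboo_Suc P_def 
    by (intro Bochner_Integration.integral_nonneg mult_nonneg_nonneg) simp_all
qed (simp add: taboo_def)

lemma taboo_decreasing:
  assumes A: "A \<in> sets borel" shows "taboo A (Suc j) x \<le> taboo A j x"
proof (induction j arbitrary: x)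
  case 0
  have "bounded_borel (indicator (- A) :: 'a \<Rightarrow> real)" using A by auto
  then have "\<bar>P (indicator (- A)) x\<bar> \<le> 1" by (rule P_bound) (auto split: split_indicator)
  then show ?case by (simp add: taboo_def)
next
  case (Suc j)
  have ib: "bounded_borel (\<lambda>y. indicator (- A) y * taboo A j y)" for j
    using A by (intro bounded_borel_mult bounded_borel_indicator taboo_bounded_borel) auto
  show ?case
    unfolding taboo_Suc[of A "Suc j"] by (subst taboo_Suc) (intro P_mono ib mult_left_mono Suc, simp)
qed

lemma taboo_le_1: "A \<in> sets borel \<Longrightarrow> taboo A j x \<le> 1"
  by (induction j) (auto simp: taboo_def[of A 0] intro: order_trans[OF taboo_decreasing])

text \<open>The limit \<open>u\<close> of the taboo probabilities satisfies \<open>u = P w\<close> for \<open>w = u\<close> off \<open>A\<close> and \<open>w = 0\<close>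
  on \<open>A\<close>; invariance of \<open>\<pi>\<close> gives \<open>u = w\<close> almost everywhere, hence \<open>u x = 0\<close> for some \<open>x\<close> in \<open>A\<close>,
  whence \<open>w = 0\<close> almost everywhere, and then everywhere as \<open>K x {x} < 1\<close>.\<close>

lemma taboo_tendsto_0:
  assumes A[measurable]: "A \<in> sets borel" and piA: "0 < emeasure \<pi> A"
  shows "(\<lambda>j. taboo A j x) \<longlonglongrightarrow> 0"
proof -
  have bm[measurable]: "taboo A j \<in> borel_measurable borel" for j
    by (rule bounded_borel_measurable[OF taboo_bounded_borel[OF A]])
  define u where "u x = lim (\<lambda>j. taboo A j x)" for x
  have lim: "(\<lambda>j. taboo A j x) \<longlonglongrightarrow> u x" for x
  proof -
    have "decseq (\<lambda>j. taboo A j x)" using taboo_decreasing[OF A] by (intro decseq_SucI)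
    then have "convergent (\<lambda>j. taboo A j x)"
      using decseq_convergent[of "\<lambda>j. taboo A j x" 0] taboo_nonneg by (metis convergentI)
    then show ?thesis by (simp add: u_def convergent_LIMSEQ_iff)
  qed
  have u0: "0 \<le> u x" for x by (rule LIMSEQ_le_const[OF lim]) (use taboo_nonneg in auto)
  have u1: "u x \<le> 1" for x by (rule LIMSEQ_le_const2[OF lim]) (use taboo_le_1[OF A] in auto)
  have um[measurable]: "u \<in> borel_measurable borel" unfolding u_def by measurable
  have ub: "bounded_borel u" by (rule bounded_borelI[where B=1]) (use u0 u1 in auto)
  define w where "w y = indicator (- A) y * u y" for y
  have wb: "bounded_borel w"
    unfolding w_def by (rule bounded_borel_mult[OF bounded_borel_indicator ub]) measurable
  have wm[measurable]: "w \<in> borel_measurable borel" by (rule bounded_borel_measurable[OF wb])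
  have w: "0 \<le> w y" "w y \<le> u y" for y using u0 by (auto simp: w_def split: split_indicator)
  have uP: "u x = P w x" for x
  proof -
    have "(\<lambda>j. P (\<lambda>y. indicator (- A) y * taboo A j y) x) \<longlonglongrightarrow> P w x"
      unfolding P_def w_def
    proof (rule integral_dominated_convergence[where w="\<lambda>_. 1"])
      show "AE y in K x. (\<lambda>j. indicator (- A) y * taboo A j y) \<longlonglongrightarrow> indicator (- A) y * u y"
        by (intro AE_I2 tendsto_mult_left lim)
      show "AE y in K x. norm (indicator (- A) y * taboo A j y) \<le> 1" for j
        using taboo_nonneg taboo_le_1[OF A] by (auto split: split_indicator)
    qed (auto simp: measurable_sets_eq)
    moreover have "(\<lambda>j. P (\<lambda>y. indicator (- A) y * taboo A j y) x) \<longlonglongrightarrow> u x"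
      using LIMSEQ_Suc[OF lim[of x]] by (simp add: taboo_Suc)
    ultimately have "P w x = u x" by (rule LIMSEQ_unique)
    then show ?thesis by simp
  qed
  have "(\<integral>x. u x \<partial>\<pi>) = (\<integral>x. w x \<partial>\<pi>)"
    using P_invariant[OF wb] uP by simp
  then have "(\<integral>x. u x - w x \<partial>\<pi>) = 0" using integrable_pi[OF ub] integrable_pi[OF wb] by simp
  then have AEu: "AE x in \<pi>. u x = w x"
    using integral_nonneg_eq_0_iff_AE[of \<pi> "\<lambda>x. u x - w x"] integrable_pi[OF ub] integrable_pi[OF wb] w by simp
  have "\<exists>x\<in>A. u x = w x"
  proof (rule ccontr)
    assume "\<not> ?thesis"
    then have "AE x in \<pi>. x \<notin> A" using AEu by (auto elim!: eventually_mono)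
    then have "emeasure \<pi> A = 0"
      using AE_iff_measurable[of A \<pi> "\<lambda>x. x \<notin> A"] by (simp add: sets_pi space_pi)
    then show False using piA by simp
  qed
  then obtain x0 where "x0 \<in> A" "u x0 = w x0" by blast
  then have "P w x0 = 0" using uP[of x0] by (simp add: w_def)
  then have "AE y in K x0. w y = 0"
    using integral_nonneg_eq_0_iff_AE[OF integrable_K[OF wb], of x0] w by (simp add: P_def)
  then have "AE y in K x0. \<not> w y \<noteq> 0" by simp
  then have "AE y in \<pi>. \<not> w y \<noteq> 0" by (rule null_of_K_null[rotated]) measurable
  then have w0: "AE y in \<pi>. w y = 0" by simp
  obtain f :: "'a \<Rightarrow> real" where fi: "integrable \<pi> f"
    and f: "P w x = measure (K x) {x} * w x + (\<integral>y. f y * w y \<partial>\<pi>)"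
    using K_decomposition[of x] wb by metis
  have [measurable]: "f \<in> borel_measurable borel"
    using borel_measurable_integrable[OF fi] by (simp add: measurable_sets_eq)
  have "(\<integral>y. f y * w y \<partial>\<pi>) = (\<integral>y. 0 \<partial>\<pi>)"
    using w0 by (intro integral_cong_AE) (auto simp: measurable_sets_eq)
  then have "u x = measure (K x) {x} * w x" using f uP by simp
  also have "\<dots> \<le> measure (K x) {x} * u x" using w by (intro mult_left_mono) auto
  finally have "(1 - measure (K x) {x}) * u x \<le> 0" by (simp add: algebra_simps)
  then have "u x \<le> 0" using K_singleton_less_1[of x] by (simp add: mult_le_0_iff)
  then show ?thesis using lim[of x] u0[of x] by simp
qed

text \<open>By the Markov property, avoiding \<open>A\<close> at the \<open>k\<close> times after
  \<open>n\<close> has as probability the mean of \<open>taboo A k\<close> at the state of time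
  \<open>n\<close>. Dominated convergence sends it to 0 as \<open>k\<close> grows, and only
  countably many \<open>n\<close> occur.\<close>

lemma chain_law_hits_infinitely_often:
  assumes A[measurable]: "A \<in> sets borel" and piA: "0 < emeasure \<pi> A"
  shows "AE \<omega> in chain_law K x. infinite {n. \<omega> n \<in> A}"
proof -
  \<comment> \<open>This matches the kernels inside \<open>chain_law\<close>: coordinate 0 is the
    starting point and coordinate \<open>i\<close> is drawn from the state at time
    \<open>i - 1\<close>.\<close>
  define Q where "Q i \<omega> = (if i = 0 then return borel x else K (\<omega> (i - 1)))" for i :: nat and \<omega> :: "nat \<Rightarrow> 'a"
  interpret IT: Ionescu_Tulcea Q "\<lambda>_. borel :: 'a measure"
  proof (rule Ionescu_Tulcea.intro, goal_cases)
    case (1 i)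
    show ?case
    proof (cases i)
      case 0
      have "Q 0 = (\<lambda>_. return borel x)" by (simp add: Q_def fun_eq_iff)
      with 0 show ?thesis
        by (simp add: prob_space_return prob_space_imp_subprob_space space_subprob_algebra)
    next
      case (Suc j)
      have "(\<lambda>\<omega>. K (\<omega> j)) \<in> PiM {0..<i} (\<lambda>_. borel) \<rightarrow>\<^sub>M subprob_algebra borel"
        using Suc by (intro measurable_component_compose K_measurable) auto
      then show ?thesis by (simp add: Q_def Suc cong: measurable_cong)
    qed
  next
    case (2 i \<omega>)
    show ?case by (simp add: Q_def prob_space_return K_prob)
  qed
  define L where "L = chain_law K x"
  have L: "L = IT.PF.lim" by (simp add: L_def chain_law_def Q_def[abs_def])
  have sets_L: "sets L = sets (PiM UNIV (\<lambda>_. borel))" by (simp add: L)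
  \<comment> \<open>The \<open>ennreal\<close> form of the operator iterated in
    \<open>taboo\<close>, suited to the nonnegative integrals of the path construction.\<close>
  define T where "T g y = (\<integral>\<^sup>+z. indicator (- A) z * g z \<partial>K y)" for g :: "'a \<Rightarrow> ennreal" and y
  have T[measurable]: "T g \<in> borel_measurable borel" if [measurable]: "g \<in> borel_measurable borel" for g
    unfolding T_def
    by (intro measurable_compose[OF K_measurable] nn_integral_measurable_subprob_algebra) measurable
  have Tn: "(T ^^ j) (\<lambda>_. 1) y = ennreal (taboo A j y)" for j y
  proof (induction j arbitrary: y)
    case (Suc j)
    have ib: "bounded_borel (\<lambda>y. indicator (- A) y * taboo A j y)"
      using A by (intro bounded_borel_mult bounded_borel_indicator taboo_bounded_borel) auto
    have "(T ^^ Suc j) (\<lambda>_. 1) y = (\<integral>\<^sup>+z. ennreal (indicator (- A) z * taboo A j z) \<partial>K y)"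
      unfolding funpow.simps comp_def T_def[of "(T ^^ j) (\<lambda>_. 1)"] Suc
      by (intro nn_integral_cong) (auto split: split_indicator)
    also have "\<dots> = ennreal (taboo A (Suc j) y)"
      unfolding taboo_Suc P_def using taboo_nonneg
      by (intro nn_integral_eq_integral integrable_K ib) auto
    finally show ?case .
  qed (simp add: taboo_def)
  \<comment> \<open>\<open>?C n\<close> is the law of the coordinates below \<open>n\<close>, so the
    state at time \<open>n\<close> first appears in \<open>?C (Suc n)\<close>.\<close>
  let ?C = "\<lambda>n. IT.C 0 n (\<lambda>_. undefined)"
  have sets_C: "sets (?C m) = sets (PiM {0..<m} (\<lambda>_. borel))" for m
    using IT.sets_C[of _ 0 m] by simp
  \<comment> \<open>The last coordinate is integrated out first, which turns \<open>g\<close> into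
    \<open>T g\<close>; therefore \<open>g\<close> varies in the induction.\<close>
  have C_eq: "(\<integral>\<^sup>+\<omega>. (\<Prod>m\<in>{n<..n+k}. indicator (- A) (\<omega> m)) * g (\<omega> (n + k)) \<partial>?C (Suc (n + k)))
      = (\<integral>\<^sup>+\<omega>. (T ^^ k) g (\<omega> n) \<partial>?C (Suc n))" if "g \<in> borel_measurable borel" for n k g
    using that
  proof (induction k arbitrary: g)
    case (Suc k)
    note [measurable] = Suc.prems
    let ?f = "\<lambda>\<omega>. (\<Prod>m\<in>{n<..n+Suc k}. indicator (- A) (\<omega> m)) * g (\<omega> (n + Suc k)) :: ennreal"
    have fm: "?f \<in> borel_measurable (PiM {0..<Suc (n + Suc k)} (\<lambda>_. borel))"
      by (intro borel_measurable_times_ennreal borel_measurable_prod_ennreal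
          measurable_component_compose[OF Suc.prems]
          measurable_component_compose[OF borel_measurable_indicator]) auto
    have "(\<integral>\<^sup>+\<omega>. ?f \<omega> \<partial>?C (Suc (n + Suc k))) =
        (\<integral>\<^sup>+\<omega>. (\<integral>\<^sup>+\<omega>'. ?f \<omega>' \<partial>IT.eP (Suc (n + k)) \<omega>) \<partial>?C (Suc (n + k)))"
    proof -
      have "IT.eP (Suc (n + k)) \<in> ?C (Suc (n + k)) \<rightarrow>\<^sub>M
          subprob_algebra (PiM {0..<Suc (n + Suc k)} (\<lambda>_. borel))"
        using IT.measurable_eP[of "Suc (n + k)"] unfolding measurable_cong_sets[OF sets_C refl] by simp
      moreover have "?C (Suc (n + Suc k)) = ?C (Suc (n + k)) \<bind> IT.eP (Suc (n + k))" by simp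
      ultimately show ?thesis using nn_integral_bind[OF fm] by (simp only:)
    qed
    also have "\<dots> = (\<integral>\<^sup>+\<omega>. (\<Prod>m\<in>{n<..n+k}. indicator (- A) (\<omega> m)) * T g (\<omega> (n + k)) \<partial>?C (Suc (n + k)))"
    proof (rule nn_integral_cong)
      fix \<omega> assume "\<omega> \<in> space (?C (Suc (n + k)))"
      then have \<omega>: "\<omega> \<in> space (PiM {0..<Suc (n + k)} (\<lambda>_. borel))"
        by (simp only: sets_eq_imp_space_eq[OF sets_C])
      have "(\<integral>\<^sup>+\<omega>'. ?f \<omega>' \<partial>IT.eP (Suc (n + k)) \<omega>) = (\<integral>\<^sup>+y. ?f (fun_upd \<omega> (Suc (n + k)) y) \<partial>K (\<omega> (n + k)))"
        using IT.nn_integral_eP[OF \<omega>, of ?f] fm by (simp add: Q_def)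
      also have "\<dots> = (\<integral>\<^sup>+y. (\<Prod>m\<in>{n<..n+k}. indicator (- A) (\<omega> m)) * (indicator (- A) y * g y) \<partial>K (\<omega> (n + k)))"
      proof (rule nn_integral_cong)
        fix y
        have "{n<..n+Suc k} = insert (Suc (n + k)) {n<..n+k}" by auto
        then have "(\<Prod>m\<in>{n<..n+Suc k}. indicator (- A) ((fun_upd \<omega> (Suc (n + k)) y) m) :: ennreal)
            = indicator (- A) y * (\<Prod>m\<in>{n<..n+k}. indicator (- A) (\<omega> m))"
          by simp
        then show "?f (fun_upd \<omega> (Suc (n + k)) y) = (\<Prod>m\<in>{n<..n+k}. indicator (- A) (\<omega> m)) * (indicator (- A) y * g y)"
          by (simp add: mult_ac)
      qed
      also have "\<dots> = (\<Prod>m\<in>{n<..n+k}. indicator (- A) (\<omega> m)) * T g (\<omega> (n + k))"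
        unfolding T_def by (rule nn_integral_cmult) (simp add: measurable_sets_eq)
      finally show "(\<integral>\<^sup>+\<omega>'. ?f \<omega>' \<partial>IT.eP (Suc (n + k)) \<omega>) = \<dots>" .
    qed
    also have "\<dots> = (\<integral>\<^sup>+\<omega>. (T ^^ k) (T g) (\<omega> n) \<partial>?C (Suc n))"
      by (rule Suc.IH[OF T[OF Suc.prems]])
    finally show ?case by (simp add: funpow_swap1)
  qed simp
  define B where "B n k = {\<omega> \<in> space L. \<forall>m\<in>{n<..n+k}. \<omega> m \<notin> A}" for n k
  have em: "emeasure L (B n k) = (\<integral>\<^sup>+\<omega>. ennreal (taboo A k (\<omega> n)) \<partial>?C (Suc n))" for n k
  proof -
    let ?J = "{0..<Suc (n + k)}"
    let ?X = "{\<omega> \<in> space (PiM ?J (\<lambda>_. borel :: 'a measure)). \<forall>m\<in>{n<..n+k}. \<omega> m \<notin> A}"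
    have X: "?X \<in> sets (PiM ?J (\<lambda>_. borel))"
      by (rule sets_Collect_avoids[OF A]) auto
    \<comment> \<open>Avoidance up to time \<open>n + k\<close> is a cylinder event, so its
      probability is computed from finitely many coordinates.\<close>
    have "B n k = prod_emb UNIV (\<lambda>_. borel) ?J ?X"
      by (auto simp: B_def prod_emb_def L space_PiM PiE_def)
    then have "emeasure L (B n k) = emeasure (IT.CI ?J) ?X"
      using X by (simp add: L IT.lim)
    also have "\<dots> = emeasure (?C (Suc (n + k))) ?X"
    proof -
      have "prod_emb ?J (\<lambda>_. borel) ?J ?X = ?X" by (rule prod_emb_id) (auto simp: space_PiM)
      then show ?thesis using IT.emeasure_CI[OF subset_refl X] by (simp only:)
    qed
    also have "\<dots> = (\<integral>\<^sup>+\<omega>. indicator ?X \<omega> \<partial>?C (Suc (n + k)))"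
      using X by (subst nn_integral_indicator) (simp_all only: sets_C)
    also have "\<dots> = (\<integral>\<^sup>+\<omega>. (\<Prod>m\<in>{n<..n+k}. indicator (- A) (\<omega> m)) * 1 \<partial>?C (Suc (n + k)))"
    proof (rule nn_integral_cong)
      fix \<omega> assume "\<omega> \<in> space (?C (Suc (n + k)))"
      then have "\<omega> \<in> space (PiM ?J (\<lambda>_. borel))" by (simp only: sets_eq_imp_space_eq[OF sets_C])
      then show "indicator ?X \<omega> = (\<Prod>m\<in>{n<..n+k}. indicator (- A) (\<omega> m)) * (1 :: ennreal)"
      proof (cases "\<forall>m\<in>{n<..n+k}. \<omega> m \<notin> A")
        case False
        then have "\<exists>m\<in>{n<..n+k}. indicator (- A) (\<omega> m) = (0 :: ennreal)"
          by (meson ComplD indicator_simps(2))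
        then have "(\<Prod>m\<in>{n<..n+k}. indicator (- A) (\<omega> m)) = (0 :: ennreal)"
          by (intro prod_zero) auto
        then show ?thesis using False by simp
      qed simp
    qed
    also have "\<dots> = (\<integral>\<^sup>+\<omega>. ennreal (taboo A k (\<omega> n)) \<partial>?C (Suc n))"
      using C_eq[of "\<lambda>_. 1" n k] by (simp add: Tn)
    finally show ?thesis .
  qed
  have Bm: "B n k \<in> sets L" for n k
    using sets_Collect_avoids[OF A, of "{n<..n+k}" UNIV]
    unfolding B_def sets_L sets_eq_imp_space_eq[OF sets_L] by simp
  have "AE \<omega> in L. \<exists>m>n. \<omega> m \<in> A" for n
  proof -
    interpret C: prob_space "?C (Suc n)" by (rule IT.prob_space_C) simp
    have "(\<lambda>k. \<integral>\<^sup>+\<omega>. ennreal (taboo A k (\<omega> n)) \<partial>?C (Suc n)) \<longlonglongrightarrow> (\<integral>\<^sup>+\<omega>. 0 \<partial>?C (Suc n))"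
    proof (rule nn_integral_dominated_convergence[where w="\<lambda>_. 1"])
      show "(\<lambda>\<omega>. ennreal (taboo A k (\<omega> n))) \<in> borel_measurable (?C (Suc n))" for k
        using measurable_component_compose[of "\<lambda>y. ennreal (taboo A k y)" borel n "{0..<Suc n}"]
          bounded_borel_measurable[OF taboo_bounded_borel[OF A], of k]
        unfolding measurable_cong_sets[OF sets_C refl] by simp
      show "AE \<omega> in ?C (Suc n). (\<lambda>k. ennreal (taboo A k (\<omega> n))) \<longlonglongrightarrow> 0"
        using tendsto_ennrealI[OF taboo_tendsto_0[OF A piA]] by simp
      show "(\<integral>\<^sup>+\<omega>. 1 \<partial>?C (Suc n)) < \<infinity>"
        using C.emeasure_space_1 by (simp del: IT.C.simps)
    qed (use taboo_le_1[OF A] in auto)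
    then have lim: "(\<lambda>k. emeasure L (B n k)) \<longlonglongrightarrow> 0" by (simp add: em)
    have "emeasure L (\<Inter>k. B n k) \<le> emeasure L (B n k)" for k
      by (intro emeasure_mono Bm) auto
    then have "emeasure L (\<Inter>k. B n k) = 0"
      using LIMSEQ_le_const[OF lim, of "emeasure L (\<Inter>k. B n k)"] by auto
    moreover have "(\<Inter>k. B n k) \<in> sets L" using Bm by auto
    moreover have "{\<omega> \<in> space L. \<not> (\<exists>m>n. \<omega> m \<in> A)} \<subseteq> (\<Inter>k. B n k)"
      unfolding B_def by auto
    ultimately show ?thesis by (intro AE_I)
  qed
  then have "AE \<omega> in L. \<forall>n. \<exists>m>n. \<omega> m \<in> A" by (simp add: AE_all_countable)
  then show ?thesis unfolding L_def[symmetric] by eventually_elim (simp add: infinite_nat_iff_unbounded)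
qed

section \<open>Accessible sets, irreducibility and aperiodicity\<close>

lemma accessible_if_pi_pos:
  assumes "A \<in> sets borel" "0 < emeasure \<pi> A" shows "accessible K A"
  unfolding accessible_def
proof
  fix x
  have "kpow K 0 = return borel" by (rule ext) simp
  then have "0 < emeasure (kpow K (Suc 0) x) A"
    using K_pos[OF assms, of x] bind_return''[OF sets_K, of x] by simp
  also have "\<dots> \<le> (\<Sum>m. emeasure (kpow K (Suc m) x) A)"
    using sum_le_suminf[of "\<lambda>m. emeasure (kpow K (Suc m) x) A" "{0}"] by simp
  finally show "0 < (\<Sum>m. emeasure (kpow K (Suc m) x) A)" .
qed

text \<open>A null set is never entered from outside: a step either stays put or is absolutely
  continuous. A point outside exists since \<pi> has mass 1.\<close>

lemma pi_pos_if_accessible: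
  assumes A: "A \<in> sets borel" and "accessible K A" shows "0 < emeasure \<pi> A"
proof (rule ccontr)
  assume "\<not> 0 < emeasure \<pi> A"
  then have null: "A \<in> null_sets \<pi>" using A by (auto simp: null_sets_def sets_pi)
  have "A \<noteq> UNIV" using null pi_UNIV by auto
  then obtain x where x: "x \<notin> A" by blast
  have "(P ^^ n) (indicator A) y = 0" if "y \<notin> A" for n y
    using that
  proof (induction n arbitrary: y)
    case (Suc n)
    have "A \<in> null_sets (K y)" using K_null[OF null Suc.prems] A by (auto simp: null_sets_def sets_K)
    then have "AE z in K y. (P ^^ n) (indicator A) z = 0"
      by (rule AE_mp[OF AE_not_in]) (use Suc.IH in auto)
    then have "(\<integral>z. (P ^^ n) (indicator A) z \<partial>K y) = (\<integral>z. 0 \<partial>K y)"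
      using bounded_borel_measurable[OF Pn_bounded_borel[OF bounded_borel_indicator[OF A]]]
      by (intro integral_cong_AE) (auto simp: measurable_sets_eq)
    then show ?case by (simp add: P_def[of "(P ^^ n) (indicator A)"])
  qed simp
  then have "measure (kpow K n x) A = 0" for n using x by (simp add: measure_kpow[OF A])
  then have "emeasure (kpow K n x) A = 0" for n
    using finite_measure.emeasure_eq_measure[OF prob_space.finite_measure[OF prob_space_kpow]] by simp
  then have "(\<Sum>m. emeasure (kpow K (Suc m) x) A) = 0" by (simp del: kpow.simps)
  then show False using assms(2) unfolding accessible_def by (metis less_irrefl)
qed

theorem K_harris_recurrent: "harris_recurrent K"
  unfolding harris_recurrent_def using chain_law_hits_infinitely_often pi_pos_if_accessible by blast

theorem irreducibility_measureI:
  assumes "sets \<mu> = sets borel" "sigma_finite_measure \<mu>" "emeasure \<mu> (space \<mu>) \<noteq> 0"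
    and "\<And>A. A \<in> sets borel \<Longrightarrow> 0 < emeasure \<mu> A \<Longrightarrow> 0 < emeasure \<pi> A"
  shows "irreducibility_measure K \<mu>"
  unfolding irreducibility_measure_def using assms accessible_if_pi_pos by blast

text \<open>Any set reached with probability one from some point has full \<open>\<pi>\<close>-measure, which is impossible
  for two disjoint sets.\<close>

theorem K_aperiodic: "aperiodic K"
  unfolding aperiodic_def
proof (intro conjI allI impI notI)
  have "irreducibility_measure K \<pi>"
    using pi_UNIV by (intro irreducibility_measureI) (auto simp: sets_pi space_pi pi.sigma_finite_measure_axioms)
  then show "irreducible K" by (auto simp: irreducible_def)
next
  fix \<psi>
  assume \<psi>: "irreducibility_measure K \<psi>"
    and "\<exists>d\<ge>2. \<exists>D. (\<forall>i<d. D i \<in> sets borel) \<and> disjoint_family_on D {..<d} \<and>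
        (\<forall>i<d. \<forall>x\<in>D i. emeasure (K x) (D (Suc i mod d)) = 1) \<and> emeasure \<psi> (UNIV - (\<Union>i<d. D i)) = 0"
  then obtain d D where d: "2 \<le> d" and D: "\<And>i. i < d \<Longrightarrow> D i \<in> sets borel"
    and disj: "disjoint_family_on D {..<d}"
    and cyc: "\<And>i x. i < d \<Longrightarrow> x \<in> D i \<Longrightarrow> emeasure (K x) (D (Suc i mod d)) = 1"
    and \<psi>D: "emeasure \<psi> (UNIV - (\<Union>i<d. D i)) = 0" by blast
  have ne: "\<exists>i<d. D i \<noteq> {}"
  proof (rule ccontr)
    assume "\<not> ?thesis"
    then have "(\<Union>i<d. D i) = {}" by auto
    with \<psi>D have "emeasure \<psi> UNIV = 0" by simp
    moreover have "space \<psi> = UNIV" using \<psi> sets_eq_imp_space_eq[of \<psi> borel] by (simp add: irreducibility_measure_def)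
    ultimately show False using \<psi> by (simp add: irreducibility_measure_def)
  qed
  then obtain i where i: "i < d" "D i \<noteq> {}" by blast
  have full: "D (Suc j mod d) \<noteq> {}" "emeasure \<pi> (- D (Suc j mod d)) = 0" if j: "j < d" "D j \<noteq> {}" for j
  proof -
    obtain x where x: "x \<in> D j" using j by blast
    have Dm: "D (Suc j mod d) \<in> sets borel" using d by (intro D) simp
    have 1: "emeasure (K x) (D (Suc j mod d)) = 1" by (rule cyc[OF j(1) x])
    then show "D (Suc j mod d) \<noteq> {}" by auto
    have "emeasure (K x) (- D (Suc j mod d)) = 0"
      using K.prob_compl[where x=x and A="D (Suc j mod d)"] Dm 1
      by (simp add: sets_K space_K Compl_eq_Diff_UNIV K.emeasure_eq_measure)
    then show "emeasure \<pi> (- D (Suc j mod d)) = 0"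
      using K_pos[of "- D (Suc j mod d)" x] Dm by (auto simp: zero_less_iff_neq_zero)
  qed
  \<comment> \<open>\<open>D i\<close> is only known to be nonempty. Its first and second successors
    have full measure, and they are distinct because \<open>d\<close> is at least 2.\<close>
  define a where "a = Suc i mod d"
  define b where "b = Suc a mod d"
  have a: "a < d" "D a \<noteq> {}" "emeasure \<pi> (- D a) = 0" using full[OF i] d by (auto simp: a_def)
  have b: "b < d" "emeasure \<pi> (- D b) = 0" using full[OF a(1,2)] d by (auto simp: b_def)
  have "a \<noteq> b" using d a(1) by (auto simp: b_def mod_Suc)
  then have "D a \<inter> D b = {}" using disj a b by (auto simp: disjoint_family_on_def)
  then have "UNIV = - D a \<union> - D b" by auto
  then have "emeasure \<pi> UNIV \<le> emeasure \<pi> (- D a) + emeasure \<pi> (- D b)"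
    using emeasure_subadditive[of "- D a" \<pi> "- D b"] D a b by (simp add: sets_pi)
  then show False using a b pi_UNIV by simp
qed

end

section \<open>Leapfrog dynamics\<close>

lemma continuous_gradient:
  assumes "\<And>q q'. norm (gradient U q - gradient U q') \<le> L * norm (q - q')"
  shows "continuous_on UNIV (gradient U)"
proof (rule lipschitz_on_continuous_on)
  \<comment> \<open>The absolute value is taken because \<open>lipschitz_on\<close> demands a
    nonnegative constant and the sign of \<open>L\<close> is not assumed here.\<close>
  show "\<bar>L\<bar>-lipschitz_on UNIV (gradient U)"
  proof (rule lipschitz_onI)
    show "dist (gradient U q) (gradient U q') \<le> \<bar>L\<bar> * dist q q'" for q q'
      using order_trans[OF assms[of q q'] mult_right_mono[OF abs_ge_self norm_ge_zero]] by (simp add: dist_norm)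
  qed simp
qed

lemma C2_continuous: "C2 U \<Longrightarrow> continuous_on UNIV U"
  unfolding C2_def by (meson continuous_at_imp_continuous_on differentiable_imp_continuous_within)

section \<open>Normalisation of the Gaussian momentum density\<close>

lemma nn_integral_gaussian_line:
  "(\<integral>\<^sup>+x. ennreal (exp (- x\<^sup>2 / 2)) \<partial>lborel) = ennreal (sqrt (2 * pi))"
proof -
  have "(\<integral>\<^sup>+x. ennreal (std_normal_density x) \<partial>lborel) = 1"
    using prob_space.emeasure_space_1[OF prob_space_normal_density[of 1 0]]
    by (simp add: emeasure_density)
  then have "ennreal (1 / sqrt (2 * pi)) * (\<integral>\<^sup>+x. ennreal (exp (- x\<^sup>2 / 2)) \<partial>lborel) = 1"
    by (subst nn_integral_cmult[symmetric]) (auto simp: std_normal_density_def ennreal_mult'[symmetric])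
  then have "ennreal (sqrt (2 * pi)) * (ennreal (1 / sqrt (2 * pi)) * (\<integral>\<^sup>+x. ennreal (exp (- x\<^sup>2 / 2)) \<partial>lborel)) = ennreal (sqrt (2 * pi))"
    by simp
  then show ?thesis by (simp add: mult.assoc[symmetric] ennreal_mult'[symmetric])
qed

lemma nn_integral_std_gauss: "(\<integral>\<^sup>+p. ennreal (std_gauss (p :: 'a::euclidean_space)) \<partial>lborel) = 1"
proof -
  have "ennreal (exp (- (norm p)\<^sup>2 / 2)) = (\<Prod>b\<in>Basis. ennreal (exp (- (p \<bullet> b)\<^sup>2 / 2)))" for p :: 'a
    unfolding power2_norm_eq_inner euclidean_inner[of p p]
    by (simp add: prod_ennreal exp_sum[symmetric] sum_negf[symmetric] sum_divide_distrib power2_eq_square)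
  then have "(\<integral>\<^sup>+p. ennreal (exp (- (norm (p :: 'a))\<^sup>2 / 2)) \<partial>lborel)
      = (\<Prod>b\<in>(Basis::'a set). \<integral>\<^sup>+x. ennreal (exp (- x\<^sup>2 / 2)) \<partial>lborel)"
    by (simp only:) (rule nn_integral_lborel_prod, auto)
  also have "\<dots> = ennreal (sqrt (2 * pi) ^ DIM('a))"
    unfolding nn_integral_gaussian_line by (simp add: ennreal_power)
  finally have *: "(\<integral>\<^sup>+p. ennreal (exp (- (norm (p :: 'a))\<^sup>2 / 2)) \<partial>lborel) = ennreal (sqrt (2 * pi) ^ DIM('a))" .
  have "(\<integral>\<^sup>+p. ennreal (std_gauss (p :: 'a)) \<partial>lborel)
      = ennreal ((2 * pi) powr (- real DIM('a) / 2)) * ennreal (sqrt (2 * pi) ^ DIM('a))"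
    unfolding *[symmetric] std_gauss_def
    by (subst nn_integral_cmult[symmetric]) (auto simp: ennreal_mult')
  also have "\<dots> = ennreal ((2 * pi) powr (- real DIM('a) / 2) * (2 * pi) powr (real DIM('a) / 2))"
    by (simp add: ennreal_mult' powr_half_sqrt[symmetric] powr_powr flip: powr_realpow)
  also have "\<dots> = 1" by (simp add: powr_add[symmetric])
  finally show ?thesis .
qed

lemma std_gauss_pos: "0 < std_gauss p"
  by (simp add: std_gauss_def)

lemma std_gauss_measurable [measurable]: "std_gauss \<in> borel_measurable borel"
  unfolding std_gauss_def by measurable

lemma accept_pos: "0 < accept U z z'" and accept_le_1: "accept U z z' \<le> 1"
  by (auto simp: accept_def)

section \<open>Momentum reversal and volume preservation\<close>

definition flip :: "'a::euclidean_space \<times> 'a \<Rightarrow> 'a \<times> 'a" where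
  "flip z = (fst z, - snd z)"

lemma flip_flip [simp]: "flip (flip z) = z" and fst_flip [simp]: "fst (flip z) = fst z"
  and ham_flip [simp]: "ham U (flip z) = ham U z"
  by (auto simp: flip_def ham_def)

text \<open>Conjugation by \<open>flip\<close> inverts \<open>psi1\<close> and \<open>psi2\<close>,
  and the leapfrog map is a palindrome in them, so it is inverted as well.\<close>

lemma leapfrog_flip: "leapfrog U h (flip (leapfrog U h z)) = flip z"
  by (simp add: leapfrog_def psi1_def psi2_def flip_def algebra_simps flip: scaleR_2 scaleR_add_left)

lemma leapfrog_iter_0: "leapfrog_iter U h 0 z = z"
  and leapfrog_iter_Suc: "leapfrog_iter U h (Suc n) z = leapfrog U h (leapfrog_iter U h n z)"
  and leapfrog_iter_Suc': "leapfrog_iter U h (Suc n) z = leapfrog_iter U h n (leapfrog U h z)"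
  by (simp_all add: leapfrog_iter_def funpow_swap1)

lemma leapfrog_iter_flip: "leapfrog_iter U h n (flip (leapfrog_iter U h n z)) = flip z"
proof (induction n arbitrary: z)
  case (Suc n)
  have "leapfrog_iter U h (Suc n) (flip (leapfrog_iter U h (Suc n) z))
      = leapfrog_iter U h n (leapfrog U h (flip (leapfrog U h (leapfrog_iter U h n z))))"
    \<comment> \<open>The outer iterate is unrolled at its first step and the inner one at its last,
      so that the two adjacent leapfrog steps cancel.\<close>
    by (simp only: leapfrog_iter_Suc'[of U h n "flip _"] leapfrog_iter_Suc[of U h n z])
  then show ?case by (simp add: leapfrog_flip Suc)
qed (simp add: leapfrog_iter_0)

text \<open>Phrased through integrals of nonnegative functions, so that it composes directly and can
  be checked by Tonelli's theorem.\<close>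

definition preserves_lborel :: "('a::euclidean_space \<times> 'a \<Rightarrow> 'a \<times> 'a) \<Rightarrow> bool" where
  "preserves_lborel F \<longleftrightarrow> F \<in> borel_measurable borel \<and>
     (\<forall>g\<in>borel_measurable borel. (\<integral>\<^sup>+z. g (F z) \<partial>lborel) = (\<integral>\<^sup>+z. (g z :: ennreal) \<partial>lborel))"

lemma preserves_lborel_measurable: "preserves_lborel F \<Longrightarrow> F \<in> borel_measurable borel"
  and preserves_lborel_nn_integral: "preserves_lborel F \<Longrightarrow> g \<in> borel_measurable borel \<Longrightarrow>
    (\<integral>\<^sup>+z. g (F z) \<partial>lborel) = (\<integral>\<^sup>+z. g z \<partial>lborel)"
  by (auto simp: preserves_lborel_def)

lemma preserves_lborel_comp:
  assumes F: "preserves_lborel F" and G: "preserves_lborel G" shows "preserves_lborel (F \<circ> G)"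
  unfolding preserves_lborel_def
proof (intro conjI ballI)
  note [measurable] = F[THEN preserves_lborel_measurable] G[THEN preserves_lborel_measurable]
  show "F \<circ> G \<in> borel_measurable borel" unfolding comp_def by measurable
  fix g :: "'a \<times> 'a \<Rightarrow> ennreal" assume [measurable]: "g \<in> borel_measurable borel"
  have "(\<integral>\<^sup>+z. g (F (G z)) \<partial>lborel) = (\<integral>\<^sup>+z. g (F z) \<partial>lborel)"
    by (rule preserves_lborel_nn_integral[OF G]) measurable
  then show "(\<integral>\<^sup>+z. g ((F \<circ> G) z) \<partial>lborel) = (\<integral>\<^sup>+z. g z \<partial>lborel)"
    using preserves_lborel_nn_integral[OF F, of g] by simp
qed

lemma nn_integral_lborel_pair:
  fixes g :: "'a::euclidean_space \<times> 'a \<Rightarrow> ennreal"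
  assumes "g \<in> borel_measurable borel"
  shows "(\<integral>\<^sup>+z. g z \<partial>lborel) = (\<integral>\<^sup>+q. \<integral>\<^sup>+p. g (q, p) \<partial>lborel \<partial>lborel)"
    and "(\<integral>\<^sup>+z. g z \<partial>lborel) = (\<integral>\<^sup>+p. \<integral>\<^sup>+q. g (q, p) \<partial>lborel \<partial>lborel)"
proof -
  have g: "g \<in> borel_measurable (lborel \<Otimes>\<^sub>M lborel)" using assms by (simp add: lborel_prod)
  show "(\<integral>\<^sup>+z. g z \<partial>lborel) = (\<integral>\<^sup>+q. \<integral>\<^sup>+p. g (q, p) \<partial>lborel \<partial>lborel)"
    using lborel.nn_integral_fst[OF g] by (simp add: lborel_prod)
  then show "(\<integral>\<^sup>+z. g z \<partial>lborel) = (\<integral>\<^sup>+p. \<integral>\<^sup>+q. g (q, p) \<partial>lborel \<partial>lborel)"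
    using lborel_pair.Fubini'[of "\<lambda>q p. g (q, p)"] g by (simp add: lborel_prod)
qed

lemma nn_integral_lborel_shift:
  fixes f :: "'a::euclidean_space \<Rightarrow> ennreal"
  assumes [measurable]: "f \<in> borel_measurable borel"
  shows "(\<integral>\<^sup>+x. f (x + c) \<partial>lborel) = (\<integral>\<^sup>+x. f x \<partial>lborel)"
proof -
  have "(\<integral>\<^sup>+x. f x \<partial>lborel) = (\<integral>\<^sup>+x. f x \<partial>distr lborel borel ((+) c))"
    by (simp add: lborel_distr_plus)
  also have "\<dots> = (\<integral>\<^sup>+x. f (c + x) \<partial>lborel)" by (rule nn_integral_distr) auto
  finally show ?thesis by (simp add: add.commute)
qed

lemma nn_integral_lborel_uminus:
  fixes f :: "'a::euclidean_space \<Rightarrow> ennreal"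
  assumes [measurable]: "f \<in> borel_measurable borel"
  shows "(\<integral>\<^sup>+x. f (- x) \<partial>lborel) = (\<integral>\<^sup>+x. f x \<partial>lborel)"
proof -
  have "(\<integral>\<^sup>+x. f x \<partial>lborel) = (\<integral>\<^sup>+x. f x \<partial>distr lborel borel uminus)"
    using lborel_affine[of "-1" "0 :: 'a"] by (simp add: density_1)
  also have "\<dots> = (\<integral>\<^sup>+x. f (- x) \<partial>lborel)" by (rule nn_integral_distr) auto
  finally show ?thesis by simp
qed

lemma borel_pair: "(borel :: ('a::euclidean_space \<times> 'a) measure) = borel \<Otimes>\<^sub>M borel"
  by (rule borel_prod[symmetric])

lemma preserves_lborel_flip: "preserves_lborel (flip :: 'a::euclidean_space \<times> 'a \<Rightarrow> _)"
  unfolding preserves_lborel_def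
proof (intro conjI ballI)
  show F[measurable]: "(flip :: 'a \<times> 'a \<Rightarrow> _) \<in> borel_measurable borel"
    unfolding flip_def by (intro borel_measurable_continuous_onI continuous_intros)
  fix g :: "'a \<times> 'a \<Rightarrow> ennreal" assume g[measurable]: "g \<in> borel_measurable borel"
  have gq: "(\<lambda>p. g (q, p)) \<in> borel_measurable borel" for q
    using g unfolding borel_pair by measurable
  have gF: "(\<lambda>z. g (flip z)) \<in> borel_measurable borel" by measurable
  have "(\<integral>\<^sup>+z. g (flip z) \<partial>lborel) = (\<integral>\<^sup>+q. \<integral>\<^sup>+p. g (q, - p) \<partial>lborel \<partial>lborel)"
    unfolding nn_integral_lborel_pair(1)[OF gF] by (simp_all add: flip_def)
  also have "\<dots> = (\<integral>\<^sup>+z. g z \<partial>lborel)"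
    by (simp add: nn_integral_lborel_uminus[OF gq] nn_integral_lborel_pair(1)[OF g])
  finally show "(\<integral>\<^sup>+z. g (flip z) \<partial>lborel) = (\<integral>\<^sup>+z. g z \<partial>lborel)" .
qed

text \<open>A shear: at fixed position the momentum is merely translated. With the momentum integral
  inside, translation invariance suffices; for \<open>psi2\<close> the order of integration is
  exchanged.\<close>

lemma preserves_lborel_psi1:
  fixes U :: "'a::euclidean_space \<Rightarrow> real"
  assumes G: "continuous_on UNIV (gradient U)" shows "preserves_lborel (psi1 U h)"
  unfolding preserves_lborel_def
proof (intro conjI ballI)
  show F[measurable]: "psi1 U h \<in> borel_measurable borel"
    unfolding psi1_def
    by (intro borel_measurable_continuous_onI continuous_intros continuous_on_compose2[OF G]) auto
  fix g :: "'a \<times> 'a \<Rightarrow> ennreal" assume g[measurable]: "g \<in> borel_measurable borel"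
  have gq: "(\<lambda>p. g (q, p)) \<in> borel_measurable borel" for q
    using g unfolding borel_pair by measurable
  have gF: "(\<lambda>z. g (psi1 U h z)) \<in> borel_measurable borel" by measurable
  have "(\<integral>\<^sup>+z. g (psi1 U h z) \<partial>lborel) = (\<integral>\<^sup>+q. \<integral>\<^sup>+p. g (q, p + - (h / 2) *\<^sub>R gradient U q) \<partial>lborel \<partial>lborel)"
    unfolding nn_integral_lborel_pair(1)[OF gF] by (simp_all add: psi1_def)
  also have "\<dots> = (\<integral>\<^sup>+z. g z \<partial>lborel)"
    by (simp only: nn_integral_lborel_shift[OF gq] nn_integral_lborel_pair(1)[OF g])
  finally show "(\<integral>\<^sup>+z. g (psi1 U h z) \<partial>lborel) = (\<integral>\<^sup>+z. g z \<partial>lborel)" .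
qed

lemma preserves_lborel_psi2: "preserves_lborel (psi2 h :: 'a::euclidean_space \<times> 'a \<Rightarrow> _)"
  unfolding preserves_lborel_def
proof (intro conjI ballI)
  show F[measurable]: "(psi2 h :: 'a \<times> 'a \<Rightarrow> _) \<in> borel_measurable borel"
    unfolding psi2_def by (intro borel_measurable_continuous_onI continuous_intros)
  fix g :: "'a \<times> 'a \<Rightarrow> ennreal" assume g[measurable]: "g \<in> borel_measurable borel"
  have gp: "(\<lambda>q. g (q, p)) \<in> borel_measurable borel" for p
    using g unfolding borel_pair by measurable
  have gF: "(\<lambda>z. g (psi2 h z)) \<in> borel_measurable borel" by measurable
  have "(\<integral>\<^sup>+z. g (psi2 h z) \<partial>lborel) = (\<integral>\<^sup>+p. \<integral>\<^sup>+q. g (q + h *\<^sub>R p, p) \<partial>lborel \<partial>lborel)"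
    unfolding nn_integral_lborel_pair(2)[OF gF] by (simp_all add: psi2_def)
  also have "\<dots> = (\<integral>\<^sup>+z. g z \<partial>lborel)"
    by (simp only: nn_integral_lborel_shift[OF gp] nn_integral_lborel_pair(2)[OF g])
  finally show "(\<integral>\<^sup>+z. g (psi2 h z) \<partial>lborel) = (\<integral>\<^sup>+z. g z \<partial>lborel)" .
qed

lemma preserves_lborel_leapfrog_iter:
  assumes "continuous_on UNIV (gradient U)" shows "preserves_lborel (leapfrog_iter U h n)"
proof (induction n)
  case 0
  then show ?case by (simp add: preserves_lborel_def leapfrog_iter_def)
next
  case (Suc n)
  have "leapfrog_iter U h (Suc n) = leapfrog U h \<circ> leapfrog_iter U h n" by (simp add: leapfrog_iter_def)
  then show ?case
    unfolding leapfrog_def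
    by (simp only:) (intro preserves_lborel_comp preserves_lborel_psi1 preserves_lborel_psi2 assms Suc)
qed

text \<open>Two trajectories are compared with free motion. Write \<open>S\<close> for
  \<open>h * real T\<close> and \<open>D\<close> for \<open>norm (p - p')\<close>. While positions
  differ by at most \<open>2 * S * D\<close>, gradients differ by at most
  \<open>2 * L * S * D\<close>. The momentum error thus grows by \<open>h\<close> times this per
  step, and the position error by \<open>h\<close> times
  \<open>3 * L * S\<^sup>2 * D\<close>.\<close>

lemma leapfrog_iter_perturbation:
  fixes U :: "'a::euclidean_space \<Rightarrow> real" and q :: 'a
  assumes lip: "\<And>q q'. norm (gradient U q - gradient U q') \<le> L * norm (q - q')"
    and L: "0 \<le> L" and h: "0 < h" and small: "6 * L * (h * real T)\<^sup>2 \<le> 1" and k: "k \<le> T"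
  defines "Q \<equiv> \<lambda>k p. fst (leapfrog_iter U h k (q, p))"
    and "R \<equiv> \<lambda>k p. snd (leapfrog_iter U h k (q, p))"
  shows "norm (Q k p - Q k p' - (real k * h) *\<^sub>R (p - p')) \<le> 3 * L * (h * real T)\<^sup>2 * (real k * h) * norm (p - p')
    \<and> norm (R k p - R k p' - (p - p')) \<le> 2 * L * (h * real T) * (real k * h) * norm (p - p')"
  using k
proof (induction k)
  case 0
  then show ?case by (simp add: Q_def R_def leapfrog_iter_0)
next
  case (Suc k)
  define D where "D = norm (p - p')"
  define S where "S = h * real T"
  have D: "0 \<le> D" and S: "0 \<le> S" using h by (auto simp: D_def S_def)
  have kh: "real k * h \<le> S" "real (Suc k) * h \<le> S" "h \<le> S"
    using Suc.prems h by (auto simp: S_def mult.commute intro!: mult_right_mono)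
  have LS: "3 * L * S\<^sup>2 \<le> 1" using small mult_nonneg_nonneg[OF L zero_le_power2[of S]] by (simp add: S_def mult.assoc)
  let ?q = "Q k p" and ?q' = "Q k p'" and ?r = "R k p" and ?r' = "R k p'"
  have IH: "norm (?q - ?q' - (real k * h) *\<^sub>R (p - p')) \<le> 3 * L * S\<^sup>2 * (real k * h) * D"
    "norm (?r - ?r' - (p - p')) \<le> 2 * L * S * (real k * h) * D"
    using Suc by (simp_all add: S_def D_def)
  \<comment> \<open>Free motion contributes at most \<open>S * D\<close>; the error is no larger
    than the free displacement since \<open>3 * L * S\<^sup>2\<close> is at most 1.\<close>
  have bound: "norm x \<le> 2 * S * D" if "norm (x - (real j * h) *\<^sub>R (p - p')) \<le> 3 * L * S\<^sup>2 * (real j * h) * D"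
    "real j * h \<le> S" for x j
  proof -
    have "norm x \<le> norm (x - (real j * h) *\<^sub>R (p - p')) + norm ((real j * h) *\<^sub>R (p - p'))"
      using norm_triangle_ineq[of "x - (real j * h) *\<^sub>R (p - p')" "(real j * h) *\<^sub>R (p - p')"] by simp
    also have "norm ((real j * h) *\<^sub>R (p - p')) = (real j * h) * D" using h by (simp add: D_def)
    also have "3 * L * S\<^sup>2 * (real j * h) * D \<le> 1 * (real j * h) * D"
      using LS h D by (intro mult_right_mono) auto
    then have "norm (x - (real j * h) *\<^sub>R (p - p')) + real j * h * D \<le> 2 * ((real j * h) * D)"
      using that by linarith
    also have "\<dots> \<le> 2 * (S * D)" using that D by (intro mult_left_mono mult_right_mono) auto
    finally show ?thesis by simp
  qed
  have q_bd: "norm (?q - ?q') \<le> 2 * S * D" using bound[OF IH(1) kh(1)] .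
  have g_bd: "norm (gradient U x - gradient U x') \<le> 2 * L * S * D" if "norm (x - x') \<le> 2 * S * D" for x x'
    using order_trans[OF lip[of x x'] mult_left_mono[OF that L]] by (simp add: mult_ac)
  define G where "G = gradient U ?q - gradient U ?q'"
  have G: "norm G \<le> 2 * L * S * D" unfolding G_def by (rule g_bd[OF q_bd])
  have QS: "Q (Suc k) y = Q k y + h *\<^sub>R (R k y - (h / 2) *\<^sub>R gradient U (Q k y))" for y
    by (simp add: Q_def R_def leapfrog_iter_Suc leapfrog_def psi1_def psi2_def)
  have RS: "R (Suc k) y = R k y - (h / 2) *\<^sub>R gradient U (Q k y) - (h / 2) *\<^sub>R gradient U (Q (Suc k) y)" for y
    by (simp add: Q_def R_def leapfrog_iter_Suc leapfrog_def psi1_def psi2_def)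
  have tri: "norm (a + b - c) \<le> norm a + norm b + norm c" "norm (a - b - c) \<le> norm a + norm b + norm c"
    for a b c :: 'a
    using norm_triangle_ineq4[of "a + b" c] norm_triangle_ineq[of a b]
      norm_triangle_ineq4[of "a - b" c] norm_triangle_ineq4[of a b] by linarith+
  have "Q (Suc k) p - Q (Suc k) p' - (real (Suc k) * h) *\<^sub>R (p - p')
      = (?q - ?q' - (real k * h) *\<^sub>R (p - p')) + h *\<^sub>R (?r - ?r' - (p - p')) - (h * (h / 2)) *\<^sub>R G"
    unfolding QS G_def by (simp add: algebra_simps)
  also have "norm \<dots> \<le> norm (?q - ?q' - (real k * h) *\<^sub>R (p - p')) + h * norm (?r - ?r' - (p - p')) + h * (h / 2) * norm G"
    using tri(1)[of "?q - ?q' - (real k * h) *\<^sub>R (p - p')" "h *\<^sub>R (?r - ?r' - (p - p'))" "(h * (h / 2)) *\<^sub>R G"] h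
    by simp
  \<comment> \<open>The 3 is 2 + 1: two units from the accumulated momentum error and one from the
    half kick, where one factor \<open>h\<close> is bounded by \<open>S\<close>.\<close>
  also have "\<dots> \<le> 3 * L * S\<^sup>2 * (real k * h) * D + h * (2 * L * S * S * D) + h * (S / 2) * (2 * L * S * D)"
  proof (intro add_mono IH(1))
    have "2 * L * S * (real k * h) * D \<le> 2 * L * S * S * D"
      using L S D kh by (intro mult_right_mono mult_left_mono) auto
    then show "h * norm (?r - ?r' - (p - p')) \<le> h * (2 * L * S * S * D)"
      using IH(2) h by (intro mult_left_mono) auto
    show "h * (h / 2) * norm G \<le> h * (S / 2) * (2 * L * S * D)"
      using G h kh S by (intro mult_mono) auto
  qed
  also have "\<dots> = 3 * L * S\<^sup>2 * (real (Suc k) * h) * D"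
    by (simp add: power2_eq_square algebra_simps)
  finally have Q1: "norm (Q (Suc k) p - Q (Suc k) p' - (real (Suc k) * h) *\<^sub>R (p - p')) \<le> 3 * L * S\<^sup>2 * (real (Suc k) * h) * D" .
  \<comment> \<open>The second half kick takes the gradient at the new position, so the position
    estimate \<open>Q1\<close> has to come first.\<close>
  define G' where "G' = gradient U (Q (Suc k) p) - gradient U (Q (Suc k) p')"
  have G': "norm G' \<le> 2 * L * S * D" unfolding G'_def by (rule g_bd[OF bound[OF Q1 kh(2)]])
  have "R (Suc k) p - R (Suc k) p' - (p - p') = (?r - ?r' - (p - p')) - (h / 2) *\<^sub>R G - (h / 2) *\<^sub>R G'"
    unfolding RS G_def G'_def by (simp add: algebra_simps)
  also have "norm \<dots> \<le> norm (?r - ?r' - (p - p')) + (h / 2) * norm G + (h / 2) * norm G'"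
    using tri(2)[of "?r - ?r' - (p - p')" "(h / 2) *\<^sub>R G" "(h / 2) *\<^sub>R G'"] h by simp
  also have "\<dots> \<le> 2 * L * S * (real k * h) * D + (h / 2) * (2 * L * S * D) + (h / 2) * (2 * L * S * D)"
    using h by (intro add_mono IH(2) mult_left_mono G G') auto
  also have "\<dots> = 2 * L * S * (real (Suc k) * h) * D" by (simp add: algebra_simps)
  finally show ?case using Q1 by (simp add: S_def D_def)
qed

section \<open>The HMC kernel\<close>

text \<open>The HMC kernel is prescribed by its values on sets; this carries its splitting into two
  measures over to integrals.\<close>

lemma nn_integral_measure_add:
  assumes sets: "sets M = sets borel" "sets M1 = sets borel" "sets M2 = sets borel"
    and em: "\<And>A. A \<in> sets borel \<Longrightarrow> emeasure M A = emeasure M1 A + emeasure M2 A"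
    and f: "f \<in> borel_measurable borel"
  shows "(\<integral>\<^sup>+x. f x \<partial>M) = (\<integral>\<^sup>+x. f x \<partial>M1) + (\<integral>\<^sup>+x. f x \<partial>M2)"
proof -
  note meas = measurable_cong_sets[OF sets(1) refl] measurable_cong_sets[OF sets(2) refl]
    measurable_cong_sets[OF sets(3) refl]
  show ?thesis
    using f
  proof (induction f rule: borel_measurable_induct)
    case (cong f g)
    then show ?case by (simp add: fun_eq_iff[symmetric])
  next
    case (set A)
    then show ?case using em[OF set] by (simp add: sets)
  next
    case (mult u c)
    then show ?case by (simp add: nn_integral_cmult meas distrib_left)
  next
    case (add u v)
    then show ?case by (simp add: nn_integral_add meas ac_simps)
  next
    case (seq U)
    have SUP: "(\<integral>\<^sup>+x. (SUP i. U i) x \<partial>N) = (SUP i. \<integral>\<^sup>+x. U i x \<partial>N)" if "sets N = sets borel" for N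
    proof -
      have "U i \<in> borel_measurable N" for i
        unfolding measurable_cong_sets[OF that refl] by (rule seq(1))
      then show ?thesis
        using nn_integral_monotone_convergence_SUP[OF seq(3)] by (simp add: image_comp)
    qed
    have inc: "incseq (\<lambda>i. \<integral>\<^sup>+x. U i x \<partial>N)" for N :: "'a measure"
      using seq(3) by (auto intro!: nn_integral_mono simp: incseq_def le_fun_def)
    have IH: "(\<integral>\<^sup>+x. U i x \<partial>M) = (\<integral>\<^sup>+x. U i x \<partial>M1) + (\<integral>\<^sup>+x. U i x \<partial>M2)" for i
      by (fact seq)
    show ?case
      unfolding SUP[OF sets(1)] SUP[OF sets(2)] SUP[OF sets(3)] IH
      by (rule ennreal_SUP_add[OF inc inc])
  qed
qed

text \<open>The conclusion is \<open>negligible\<close> because an image need not be Borel; the next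
  lemma returns to null sets of \<open>lborel\<close> for Borel sets.\<close>

lemma null_sets_lborel_Lipschitz_image:
  fixes f :: "'a::euclidean_space \<Rightarrow> 'a"
  assumes "S \<in> null_sets lborel" "\<And>x y. x \<in> S \<Longrightarrow> y \<in> S \<Longrightarrow> norm (f x - f y) \<le> B * norm (x - y)"
  shows "negligible (f ` S)"
proof (rule negligible_locally_Lipschitz_image[OF le_refl])
  show "negligible S" using assms(1) by (simp add: negligible_iff_null_sets null_sets_completionI)
  show "\<exists>T B. open T \<and> x \<in> T \<and> (\<forall>y\<in>S \<inter> T. norm (f y - f x) \<le> B * norm (y - x))" if "x \<in> S" for x
    using assms(2)[OF _ that] by (intro exI[of _ UNIV] exI[of _ B]) auto
qed

lemma null_sets_lborel_of_negligible:
  "negligible S \<Longrightarrow> S \<in> sets borel \<Longrightarrow> S \<in> null_sets lborel"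
  by (auto simp: negligible_iff_null_sets null_sets_def emeasure_completion)

locale hmc =
  fixes U :: "'a::euclidean_space \<Rightarrow> real" and h L :: real and T :: nat
  assumes U_cont: "continuous_on UNIV U"
    and U_int: "(\<integral>\<^sup>+q. ennreal (exp (- U q)) \<partial>lborel) < \<infinity>"
    and lip: "\<And>q q'. norm (gradient U q - gradient U q') \<le> L * norm (q - q')"
    and L_nonneg: "0 \<le> L" and h_pos: "0 < h" and T_pos: "1 \<le> T"
    and small: "6 * L * (h * real T)\<^sup>2 \<le> 1"
begin

definition F :: "'a \<times> 'a \<Rightarrow> 'a \<times> 'a" where "F = leapfrog_iter U h T"
definition G :: "'a \<Rightarrow> 'a \<Rightarrow> 'a" where "G q p = fst (F (q, p))"
definition a :: "'a \<times> 'a \<Rightarrow> real" where "a z = accept U z (F z)"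
definition Z :: real where "Z = (\<integral>q. exp (- U q) \<partial>lborel)"
definition reject :: "'a \<Rightarrow> ennreal" where
  "reject q = (\<integral>\<^sup>+p. ennreal ((1 - a (q, p)) * std_gauss p) \<partial>lborel)"

lemma U_measurable [measurable]: "U \<in> borel_measurable borel"
  by (rule borel_measurable_continuous_onI[OF U_cont])

lemma F_preserves: "preserves_lborel F"
  unfolding F_def by (rule preserves_lborel_leapfrog_iter[OF continuous_gradient[OF lip]])

lemma F_measurable [measurable]: "F \<in> borel_measurable borel"
  by (rule preserves_lborel_measurable[OF F_preserves])

lemma F_measurable' [measurable]: "F \<in> borel \<Otimes>\<^sub>M borel \<rightarrow>\<^sub>M borel \<Otimes>\<^sub>M borel"
  using F_measurable by (simp add: borel_prod)

lemma a_measurable' [measurable]: "a \<in> borel_measurable (borel \<Otimes>\<^sub>M borel)"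
  unfolding a_def accept_def ham_def by measurable

lemma G_measurable [measurable]: "G q \<in> borel_measurable borel"
  unfolding G_def by measurable

lemma a_bounds: "0 < a z" "a z \<le> 1"
  by (simp_all add: a_def accept_pos accept_le_1)

section \<open>The final position as a bi-Lipschitz function of the momentum\<close>

lemma G_perturbation: "norm (G q p - G q p' - (h * real T) *\<^sub>R (p - p')) \<le> (h * real T) / 2 * norm (p - p')"
proof -
  have "3 * L * (h * real T)\<^sup>2 \<le> 1 / 2" using small by simp
  then have "3 * L * (h * real T)\<^sup>2 * (real T * h) * norm (p - p') \<le> 1 / 2 * (real T * h) * norm (p - p')"
    using h_pos by (intro mult_right_mono) auto
  moreover have "norm (G q p - G q p' - (real T * h) *\<^sub>R (p - p')) \<le> 3 * L * (h * real T)\<^sup>2 * (real T * h) * norm (p - p')"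
    using leapfrog_iter_perturbation[OF lip L_nonneg h_pos small order_refl, of q p p'] by (simp add: G_def F_def)
  ultimately show ?thesis by (simp add: mult.commute)
qed

lemma hT_pos: "0 < h * real T"
  using h_pos T_pos by simp

lemma G_lipschitz: "norm (G q p - G q p') \<le> (3 / 2 * (h * real T)) * norm (p - p')"
  and G_expanding: "norm (p - p') \<le> 2 / (h * real T) * norm (G q p - G q p')"
proof -
  define c where "c = h * real T"
  have c: "0 < c" using hT_pos by (simp add: c_def)
  define v where "v = c *\<^sub>R (p - p')"
  define u where "u = G q p - G q p'"
  have v: "norm v = c * norm (p - p')" using c by (simp add: v_def)
  have uv: "norm (u - v) \<le> norm v / 2"
    using G_perturbation[of q p p'] unfolding v by (simp add: u_def v_def c_def)
  have "norm u \<le> 3 / 2 * norm v" using norm_triangle_ineq[of "u - v" v] uv by simp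
  then show "norm (G q p - G q p') \<le> (3 / 2 * (h * real T)) * norm (p - p')"
    by (simp add: v u_def c_def)
  have "norm v \<le> 2 * norm u" using norm_triangle_ineq4[of u "u - v"] uv by simp
  then show "norm (p - p') \<le> 2 / (h * real T) * norm (G q p - G q p')"
    using c unfolding v by (simp add: u_def c_def field_simps)
qed

lemma G_inj: "inj (G q)"
proof (rule injI)
  fix p p' assume "G q p = G q p'"
  then show "p = p'" using G_expanding[of p p' q] by simp
qed

text \<open>A preimage of \<open>y\<close> is a fixed point of the Newton-like map
  \<open>?f\<close>, which uses the slope of free motion; the perturbation bound makes it a
  contraction with factor 1/2.\<close>

lemma G_surj: "surj (G q)"
  unfolding surj_def
proof
  show "\<exists>p. y = G q p" for y
  proof -
    define \<tau> where "\<tau> = h * real T"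
    have \<tau>: "0 < \<tau>" using hT_pos by (simp add: \<tau>_def)
    let ?f = "\<lambda>p. p + (1 / \<tau>) *\<^sub>R (y - G q p)"
    have "dist (?f p) (?f p') \<le> 1 / 2 * dist p p'" for p p'
    proof -
      have "?f p - ?f p' = (- 1 / \<tau>) *\<^sub>R (G q p - G q p' - \<tau> *\<^sub>R (p - p'))"
        using \<tau> by (simp add: algebra_simps)
      then have "norm (?f p - ?f p') = (1 / \<tau>) * norm (G q p - G q p' - \<tau> *\<^sub>R (p - p'))"
        using \<tau> by simp
      also have "\<dots> \<le> (1 / \<tau>) * (\<tau> / 2 * norm (p - p'))"
        using \<tau> G_perturbation[of q p p'] by (intro mult_left_mono) (auto simp: \<tau>_def)
      finally show ?thesis using \<tau> by (simp add: dist_norm)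
    qed
    then obtain p where "?f p = p"
      using banach_fix_type[of "1 / 2" ?f] by auto
    then have "y = G q p" using \<tau> by simp
    then show ?thesis by blast
  qed
qed

text \<open>The preimage of \<open>N\<close> lies in its image under the inverse map, which is
  Lipschitz by \<open>G_expanding\<close>.\<close>

lemma G_vimage_null:
  assumes N: "N \<in> null_sets lborel" shows "{p. G q p \<in> N} \<in> null_sets lborel"
proof (rule null_sets_lborel_of_negligible)
  have [measurable]: "N \<in> sets borel" using N by auto
  show "{p. G q p \<in> N} \<in> sets borel" by measurable
  have "negligible (inv (G q) ` N)"
  proof (rule null_sets_lborel_Lipschitz_image[OF N])
    show "norm (inv (G q) x - inv (G q) y) \<le> 2 / (h * real T) * norm (x - y)" for x y
      using G_expanding[of "inv (G q) x" "inv (G q) y" q] by (simp add: surj_f_inv_f[OF G_surj])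
  qed
  moreover have "{p. G q p \<in> N} \<subseteq> inv (G q) ` N" by (force simp: inv_f_f[OF G_inj])
  ultimately show "negligible {p. G q p \<in> N}" by (rule negligible_subset)
qed

lemma G_null_of_vimage_null:
  assumes [measurable]: "A \<in> sets borel" and null: "{p. G q p \<in> A} \<in> null_sets lborel"
  shows "A \<in> null_sets lborel"
proof (rule null_sets_lborel_of_negligible)
  have "negligible (G q ` {p. G q p \<in> A})"
    by (rule null_sets_lborel_Lipschitz_image[OF null G_lipschitz])
  moreover have "A \<subseteq> G q ` {p. G q p \<in> A}"
    using image_vimage_eq[of "G q" A] G_surj[of q] by (simp add: vimage_def)
  ultimately show "negligible A" by (rule negligible_subset)
qed fact

section \<open>Accepted and rejected mass of the kernel\<close>

definition moved :: "'a \<Rightarrow> 'a measure" where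
  "moved q = distr (density lborel (\<lambda>p. ennreal (a (q, p) * std_gauss p))) borel (G q)"

definition stayed :: "'a \<Rightarrow> 'a measure" where
  "stayed q = scale_measure (reject q) (return borel q)"

lemma emeasure_moved:
  assumes [measurable]: "A \<in> sets borel"
  shows "emeasure (moved q) A = (\<integral>\<^sup>+p. ennreal (indicator A (G q p) * a (q, p) * std_gauss p) \<partial>lborel)"
proof -
  have "emeasure (moved q) A = emeasure (density lborel (\<lambda>p. ennreal (a (q, p) * std_gauss p))) {p. G q p \<in> A}"
    unfolding moved_def by (subst emeasure_distr) (auto simp: vimage_def)
  also have "\<dots> = (\<integral>\<^sup>+p. ennreal (a (q, p) * std_gauss p) * indicator {p. G q p \<in> A} p \<partial>lborel)"
    by (rule emeasure_density) measurable
  also have "\<dots> = (\<integral>\<^sup>+p. ennreal (indicator A (G q p) * a (q, p) * std_gauss p) \<partial>lborel)"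
    by (intro nn_integral_cong) (auto split: split_indicator)
  finally show ?thesis .
qed

lemma emeasure_stayed: "A \<in> sets borel \<Longrightarrow> emeasure (stayed q) A = indicator A q * reject q"
  by (simp add: stayed_def mult.commute)

lemma sets_moved: "sets (moved q) = sets borel" and sets_stayed: "sets (stayed q) = sets borel"
  by (simp_all add: moved_def stayed_def)

abbreviation K :: "'a \<Rightarrow> 'a measure" where "K \<equiv> hmc_kernel U h T"

lemma sets_K: "sets (K q) = sets borel"
  unfolding hmc_kernel_def using sets.sigma_sets_eq[of "borel :: 'a measure"] by simp

lemma space_K: "space (K q) = UNIV"
  using sets_eq_imp_space_eq[OF sets_K] by simp

text \<open>\<open>measure_of\<close> returns the prescribed set function only if that is countably
  additive. Here additivity is inherited from \<open>moved\<close> and \<open>stayed\<close>, which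
  are measures by construction.\<close>

lemma emeasure_K:
  assumes A: "A \<in> sets borel"
  shows "emeasure (K q) A = emeasure (moved q) A + emeasure (stayed q) A"
proof -
  have eq: "emeasure (moved q) A + emeasure (stayed q) A =
      (\<integral>\<^sup>+p. ennreal (indicator A (fst (leapfrog_iter U h T (q, p)))
                    * accept U (q, p) (leapfrog_iter U h T (q, p)) * std_gauss p) \<partial>lborel)
        + indicator A q * (\<integral>\<^sup>+p. ennreal ((1 - accept U (q, p) (leapfrog_iter U h T (q, p)))
                    * std_gauss p) \<partial>lborel)" (is "_ = ?\<mu> A") if "A \<in> sets borel" for A
    using that by (simp add: emeasure_moved emeasure_stayed reject_def a_def G_def F_def)
  show ?thesis
    unfolding eq[OF A]
  proof (rule emeasure_measure_of[OF hmc_kernel_def])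
    show "sets (borel :: 'a measure) \<subseteq> Pow UNIV" by simp
    show "A \<in> sets (K q)" using A by (simp add: sets_K)
    have "?\<mu> {} = 0" by simp
    then show "positive (sets (K q)) ?\<mu>" by (simp add: positive_def)
    show "countably_additive (sets (K q)) ?\<mu>"
    proof (rule countably_additiveI)
      fix B :: "nat \<Rightarrow> 'a set"
      assume "range B \<subseteq> sets (K q)" and disj: "disjoint_family B"
      then have B: "range B \<subseteq> sets borel" "\<And>i. B i \<in> sets borel" "(\<Union>i. B i) \<in> sets borel"
        by (auto simp: sets_K)
      have "(\<Sum>i. ?\<mu> (B i)) = (\<Sum>i. emeasure (moved q) (B i) + emeasure (stayed q) (B i))"
        using eq[OF B(2)] by simp
      also have "\<dots> = (\<Sum>i. emeasure (moved q) (B i)) + (\<Sum>i. emeasure (stayed q) (B i))"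
        by (intro suminf_add[symmetric] summableI)
      also have "\<dots> = emeasure (moved q) (\<Union>i. B i) + emeasure (stayed q) (\<Union>i. B i)"
        using B(1) disj by (simp add: suminf_emeasure sets_moved sets_stayed)
      also have "\<dots> = ?\<mu> (\<Union>i. B i)" by (rule eq[OF B(3)])
      finally show "(\<Sum>i. ?\<mu> (B i)) = ?\<mu> (\<Union>i. B i)" .
    qed
  qed
qed

lemma nn_integral_K:
  assumes [measurable]: "g \<in> borel_measurable borel"
  shows "(\<integral>\<^sup>+y. g y \<partial>K q) = (\<integral>\<^sup>+p. ennreal (a (q, p) * std_gauss p) * g (G q p) \<partial>lborel) + reject q * g q"
proof -
  have "(\<integral>\<^sup>+y. g y \<partial>K q) = (\<integral>\<^sup>+y. g y \<partial>moved q) + (\<integral>\<^sup>+y. g y \<partial>stayed q)"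
    by (rule nn_integral_measure_add[OF sets_K sets_moved sets_stayed]) (use assms in \<open>auto simp: emeasure_K\<close>)
  moreover have "(\<integral>\<^sup>+y. g y \<partial>moved q) = (\<integral>\<^sup>+p. ennreal (a (q, p) * std_gauss p) * g (G q p) \<partial>lborel)"
    unfolding moved_def by (subst nn_integral_distr) (simp_all add: nn_integral_density)
  moreover have "(\<integral>\<^sup>+y. g y \<partial>stayed q) = reject q * g q"
    unfolding stayed_def by (simp add: nn_integral_scale_measure nn_integral_return)
  ultimately show ?thesis by simp
qed

lemma prob_space_K: "prob_space (K q)"
proof (rule prob_spaceI)
  have "emeasure (K q) (space (K q)) = (\<integral>\<^sup>+p. ennreal (a (q, p) * std_gauss p) + ennreal ((1 - a (q, p)) * std_gauss p) \<partial>lborel)"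
    by (simp add: space_K emeasure_K emeasure_moved emeasure_stayed reject_def nn_integral_add)
  also have "\<dots> = (\<integral>\<^sup>+p. ennreal (std_gauss (p :: 'a)) \<partial>lborel)"
  proof (rule nn_integral_cong)
    fix p
    have "ennreal (a (q, p) * std_gauss p) + ennreal ((1 - a (q, p)) * std_gauss p)
        = ennreal (a (q, p) * std_gauss p + (1 - a (q, p)) * std_gauss p)"
      using a_bounds[of "(q, p)"] std_gauss_pos[of p] by (intro ennreal_plus[symmetric]) auto
    then show "ennreal (a (q, p) * std_gauss p) + ennreal ((1 - a (q, p)) * std_gauss p) = ennreal (std_gauss p)"
      by (simp add: algebra_simps)
  qed
  finally show "emeasure (K q) (space (K q)) = 1" by (simp add: nn_integral_std_gauss)
qed

lemma reject_measurable [measurable]: "reject \<in> borel_measurable borel"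
  unfolding reject_def by measurable

lemma measurable_K: "K \<in> borel \<rightarrow>\<^sub>M subprob_algebra borel"
proof (rule measurable_subprob_algebra)
  show "subprob_space (K q)" for q by (rule prob_space_imp_subprob_space[OF prob_space_K])
  show "sets (K q) = sets borel" for q by (rule sets_K)
  fix A :: "'a set" assume [measurable]: "A \<in> sets borel"
  have "(\<lambda>q. \<integral>\<^sup>+p. ennreal (indicator A (G q p) * a (q, p) * std_gauss p) \<partial>lborel) \<in> borel_measurable borel"
    unfolding G_def by measurable
  then show "(\<lambda>q. emeasure (K q) A) \<in> borel_measurable borel"
    by (simp add: emeasure_K emeasure_moved emeasure_stayed)
qed

section \<open>The target measure and detailed balance\<close>

lemma Z_nn: "(\<integral>\<^sup>+q. ennreal (exp (- U q)) \<partial>lborel) = ennreal Z" and Z_pos: "0 < Z"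
proof -
  have "integrable lborel (\<lambda>q. exp (- U q))"
    using U_int by (intro integrableI_nonneg) auto
  then show *: "(\<integral>\<^sup>+q. ennreal (exp (- U q)) \<partial>lborel) = ennreal Z"
    unfolding Z_def by (intro nn_integral_eq_integral) auto
  have "(\<integral>\<^sup>+q. ennreal (exp (- U q)) \<partial>lborel) \<noteq> 0"
  proof
    assume "(\<integral>\<^sup>+q. ennreal (exp (- U q)) \<partial>lborel) = 0"
    then have "AE q in lborel. ennreal (exp (- U q)) = 0" by (subst (asm) nn_integral_0_iff_AE) auto
    then have "AE q in (lborel :: 'a measure). False" by simp
    then show False by (simp add: AE_iff_null null_sets_def)
  qed
  then show "0 < Z" using * by (metis ennreal_eq_0_iff not_less)
qed

lemma target_eq: "target U = density lborel (\<lambda>q. ennreal (exp (- U q) / Z))"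
  by (simp add: target_def Z_def)

lemma sets_target: "sets (target U) = sets borel"
  by (simp add: target_eq)

lemma prob_space_target: "prob_space (target U)"
proof (rule prob_spaceI)
  have "emeasure (target U) (space (target U)) = (\<integral>\<^sup>+q. ennreal (1 / Z) * ennreal (exp (- U q)) \<partial>lborel)"
    unfolding target_eq using Z_pos
    by (subst emeasure_density) (auto simp: ennreal_mult'[symmetric] intro!: nn_integral_cong)
  also have "\<dots> = 1"
    using Z_pos by (subst nn_integral_cmult) (auto simp: Z_nn ennreal_mult'[symmetric])
  finally show "emeasure (target U) (space (target U)) = 1" .
qed

lemma null_sets_target: "null_sets (target U) = null_sets lborel"
proof -
  have "\<not> exp (- U q) / Z \<le> 0" for q using Z_pos by (simp add: field_simps)
  then have "A \<in> null_sets (target U) \<longleftrightarrow> A \<in> sets lborel \<and> (AE q in lborel. q \<notin> A)" for A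
    unfolding target_eq by (subst null_sets_density_iff) (simp_all add: ennreal_eq_0_iff)
  moreover have "A \<in> null_sets lborel \<longleftrightarrow> A \<in> sets lborel \<and> (AE q in lborel. q \<notin> A)" for A :: "'a set"
    using AE_iff_null_sets[of A lborel] by blast
  ultimately show ?thesis by blast
qed

lemma target_pos_iff: "A \<in> sets borel \<Longrightarrow> 0 < emeasure (target U) A \<longleftrightarrow> 0 < emeasure lborel A"
  using null_sets_target by (auto simp: null_sets_def sets_target zero_less_iff_neq_zero)

text \<open>The composition of the trajectory map with momentum reversal is a volume preserving involution
  \<open>S\<close>, and the flow of mass from \<open>z\<close> to \<open>S z\<close> is proportional to \<open>min (exp (- H z)) (exp (- H (S z)))\<close>.\<close>

lemma detailed_balance:
  fixes f g :: "'a \<Rightarrow> ennreal"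
  assumes [measurable]: "f \<in> borel_measurable borel" "g \<in> borel_measurable borel"
  shows "(\<integral>\<^sup>+q. f q * (\<integral>\<^sup>+y. g y \<partial>K q) \<partial>target U) = (\<integral>\<^sup>+q. g q * (\<integral>\<^sup>+y. f y \<partial>K q) \<partial>target U)"
proof -
  define S where "S = flip \<circ> F"
  have S: "preserves_lborel S"
    unfolding S_def by (rule preserves_lborel_comp[OF preserves_lborel_flip F_preserves])
  have [measurable]: "S \<in> borel \<Otimes>\<^sub>M borel \<rightarrow>\<^sub>M borel \<Otimes>\<^sub>M borel"
    using preserves_lborel_measurable[OF S] by (simp add: borel_prod)
  have SS: "S (S z) = z" for z by (simp add: S_def F_def leapfrog_iter_flip)
  \<comment> \<open>The Gaussian constant divided by \<open>Z\<close>, so that \<open>w\<close>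
    becomes the joint density of position and momentum times the acceptance probability.\<close>
  define C where "C = (2 * pi) powr (- real DIM('a) / 2) / Z"
  have C: "0 \<le> C" using Z_pos by (simp add: C_def)
  define w where "w z = C * min (exp (- ham U z)) (exp (- ham U (S z)))" for z
  have [measurable]: "w \<in> borel_measurable (borel \<Otimes>\<^sub>M borel)"
    unfolding w_def ham_def by measurable
  have w_eq: "w z = exp (- U (fst z)) / Z * (a z * std_gauss (snd z))" for z
  proof -
    have "min 1 (exp (ham U z - ham U (F z))) * exp (- ham U z) = min (exp (- ham U z)) (exp (- ham U (S z)))"
      by (simp add: S_def min_mult_distrib_right exp_add[symmetric])
    moreover have "exp (- ham U z) = exp (- U (fst z)) * exp (- (norm (snd z))\<^sup>2 / 2)"
      by (simp add: ham_def exp_add[symmetric])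
    ultimately show ?thesis
      by (simp add: w_def C_def a_def accept_def std_gauss_def mult_ac)
  qed
  \<comment> \<open>The accepted flow. Positions do not notice the momentum reversal in
    \<open>S\<close>, so \<open>fst (S z)\<close> is the proposed position.\<close>
  define J where "J f g = (\<integral>\<^sup>+z. ennreal (w z) * f (fst z) * g (fst (S z)) \<partial>lborel)" for f g :: "'a \<Rightarrow> ennreal"
  have J_sym: "J f g = J g f" if [measurable]: "f \<in> borel_measurable borel" "g \<in> borel_measurable borel" for f g
  proof -
    have "J f g = (\<integral>\<^sup>+z. ennreal (w (S z)) * f (fst (S z)) * g (fst (S (S z))) \<partial>lborel)"
      unfolding J_def
      by (rule preserves_lborel_nn_integral[OF S, symmetric]) (unfold borel_pair, measurable)
    also have "\<dots> = J g f"
      unfolding J_def SS by (intro nn_integral_cong) (simp add: w_def SS min.commute mult_ac)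
    finally show ?thesis .
  qed
  \<comment> \<open>The rejected mass stays in place and contributes a term symmetric in
    \<open>f\<close> and \<open>g\<close>; only \<open>J\<close> needs the involution.\<close>
  have *: "(\<integral>\<^sup>+q. f q * (\<integral>\<^sup>+y. g y \<partial>K q) \<partial>target U)
      = J f g + (\<integral>\<^sup>+q. ennreal (exp (- U q) / Z) * reject q * (f q * g q) \<partial>lborel)"
    if [measurable]: "f \<in> borel_measurable borel" "g \<in> borel_measurable borel" for f g
  proof -
    have m[measurable]: "(\<lambda>q. \<integral>\<^sup>+p. ennreal (a (q, p) * std_gauss p) * g (G q p) \<partial>lborel) \<in> borel_measurable borel"
      unfolding G_def by measurable
    have "(\<integral>\<^sup>+q. f q * (\<integral>\<^sup>+y. g y \<partial>K q) \<partial>target U)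
        = (\<integral>\<^sup>+q. ennreal (exp (- U q) / Z) * (f q * ((\<integral>\<^sup>+p. ennreal (a (q, p) * std_gauss p) * g (G q p) \<partial>lborel) + reject q * g q)) \<partial>lborel)"
      unfolding target_eq by (subst nn_integral_density) (auto simp: nn_integral_K)
    also have "\<dots> = (\<integral>\<^sup>+q. ennreal (exp (- U q) / Z) * f q * (\<integral>\<^sup>+p. ennreal (a (q, p) * std_gauss p) * g (G q p) \<partial>lborel)
        + ennreal (exp (- U q) / Z) * reject q * (f q * g q) \<partial>lborel)"
      by (intro nn_integral_cong) (simp add: distrib_left mult_ac)
    also have "\<dots> = (\<integral>\<^sup>+q. ennreal (exp (- U q) / Z) * f q * (\<integral>\<^sup>+p. ennreal (a (q, p) * std_gauss p) * g (G q p) \<partial>lborel) \<partial>lborel)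
        + (\<integral>\<^sup>+q. ennreal (exp (- U q) / Z) * reject q * (f q * g q) \<partial>lborel)"
      by (rule nn_integral_add) measurable
    also have "(\<integral>\<^sup>+q. ennreal (exp (- U q) / Z) * f q * (\<integral>\<^sup>+p. ennreal (a (q, p) * std_gauss p) * g (G q p) \<partial>lborel) \<partial>lborel)
        = (\<integral>\<^sup>+q. (\<integral>\<^sup>+p. ennreal (w (q, p)) * f (fst (q, p)) * g (fst (S (q, p))) \<partial>lborel) \<partial>lborel)"
    proof (rule nn_integral_cong)
      fix q
      have "(\<lambda>p. ennreal (a (q, p) * std_gauss p) * g (G q p)) \<in> borel_measurable lborel" by measurable
      then have "ennreal (exp (- U q) / Z) * f q * (\<integral>\<^sup>+p. ennreal (a (q, p) * std_gauss p) * g (G q p) \<partial>lborel)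
          = (\<integral>\<^sup>+p. ennreal (exp (- U q) / Z) * f q * (ennreal (a (q, p) * std_gauss p) * g (G q p)) \<partial>lborel)"
        by (rule nn_integral_cmult[symmetric])
      also have "\<dots> = (\<integral>\<^sup>+p. ennreal (w (q, p)) * f (fst (q, p)) * g (fst (S (q, p))) \<partial>lborel)"
      proof (rule nn_integral_cong)
        fix p
        have "ennreal (w (q, p)) = ennreal (exp (- U q) / Z) * ennreal (a (q, p) * std_gauss p)"
          unfolding w_eq using Z_pos by (subst ennreal_mult'[symmetric]) auto
        moreover have "fst (S (q, p)) = G q p" by (simp add: S_def G_def)
        ultimately show "ennreal (exp (- U q) / Z) * f q * (ennreal (a (q, p) * std_gauss p) * g (G q p))
            = ennreal (w (q, p)) * f (fst (q, p)) * g (fst (S (q, p)))"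
          by (simp only: fst_conv mult_ac)
      qed
      finally show "ennreal (exp (- U q) / Z) * f q * (\<integral>\<^sup>+p. ennreal (a (q, p) * std_gauss p) * g (G q p) \<partial>lborel) = \<dots>" .
    qed
    also have "\<dots> = J f g"
      unfolding J_def by (rule nn_integral_lborel_pair(1)[symmetric]) (unfold borel_pair, measurable)
    finally show ?thesis .
  qed
  show ?thesis using J_sym[of f g] by (simp add: * mult.commute[of "f _" "g _"])
qed

sublocale reversible_chain K "target U"
proof (rule reversible_chain.intro)
  \<comment> \<open>Since \<open>q\<close> lies outside \<open>N\<close>, the rejected mass does not
    count and only the preimage of \<open>N\<close> under \<open>G q\<close> matters.\<close>
  show "emeasure (K q) N = 0" if N: "N \<in> null_sets (target U)" and q: "q \<notin> N" for N q
  proof -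
    have N': "N \<in> null_sets lborel" "N \<in> sets borel" using N by (auto simp: null_sets_target)
    have "AE p in lborel. p \<notin> {p. G q p \<in> N}" by (rule AE_not_in[OF G_vimage_null[OF N'(1)]])
    then have "AE p in lborel. ennreal (indicator N (G q p) * a (q, p) * std_gauss p) = 0"
      by eventually_elim simp
    then have "(\<integral>\<^sup>+p. ennreal (indicator N (G q p) * a (q, p) * std_gauss p) \<partial>lborel) = (\<integral>\<^sup>+p. 0 \<partial>(lborel :: 'a measure))"
      by (rule nn_integral_cong_AE)
    then show ?thesis using q N' by (simp add: emeasure_K emeasure_moved emeasure_stayed)
  qed
  show "0 < emeasure (K q) A" if A[measurable]: "A \<in> sets borel" and pos: "0 < emeasure (target U) A" for A q
  proof (rule ccontr)
    assume "\<not> 0 < emeasure (K q) A"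
    then have "(\<integral>\<^sup>+p. ennreal (indicator A (G q p) * a (q, p) * std_gauss p) \<partial>lborel) = 0"
      by (simp add: emeasure_K[OF A] emeasure_moved[OF A])
    then have "AE p in lborel. ennreal (indicator A (G q p) * a (q, p) * std_gauss p) = 0"
      by (subst (asm) nn_integral_0_iff_AE) auto
    then have "AE p in lborel. \<not> G q p \<in> A"
    proof eventually_elim
      fix p assume *: "ennreal (indicator A (G q p) * a (q, p) * std_gauss p) = 0"
      show "\<not> G q p \<in> A"
      proof
        assume "G q p \<in> A"
        then have "a (q, p) * std_gauss p \<le> 0" using * by (simp add: ennreal_eq_0_iff)
        then show False using mult_pos_pos[OF a_bounds(1)[of "(q, p)"] std_gauss_pos[of p]] by linarith
      qed
    qed
    then have "{p. G q p \<in> A} \<in> null_sets lborel"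
      using AE_iff_null[of lborel "\<lambda>p. G q p \<notin> A"] by simp
    then have "A \<in> null_sets lborel" by (rule G_null_of_vimage_null[OF A])
    then show False using pos by (simp add: target_pos_iff null_sets_def)
  qed
  show "emeasure (target U) {x} = 0" for x
  proof -
    have "{x} \<in> null_sets (target U)" unfolding null_sets_target by (rule finite_imp_null_set_lborel) simp
    then show ?thesis by (simp add: null_sets_def)
  qed
qed (rule measurable_K prob_space_K prob_space_target sets_target detailed_balance; assumption)+

lemma irreducibility_measure_lborel: "irreducibility_measure K lborel"
  by (rule irreducibility_measureI) (auto simp: target_pos_iff sigma_finite_lborel)

end

theorem theorem2:
  fixes U :: "'a::euclidean_space \<Rightarrow> real" and \<beta> :: real
  assumes "0 \<le> \<beta>" and "\<beta> \<le> 1"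
    and "C2 U"
    and "(\<integral>\<^sup>+q. ennreal (exp (- U q)) \<partial>lborel) < \<infinity>"
    and "\<exists>L1\<ge>0. \<forall>q q'. norm (gradient U q - gradient U q') \<le> L1 * norm (q - q')"
    and "\<exists>M1\<ge>0. \<forall>q. norm (gradient U q) \<le> M1 * (1 + norm q powr \<beta>)"
  shows "\<forall>T::nat. T \<ge> 1 \<longrightarrow> (\<exists>ht > 0. \<forall>h. 0 < h \<and> h \<le> ht \<longrightarrow>
           irreducible (hmc_kernel U h T) \<and>
           irreducibility_measure (hmc_kernel U h T) lborel \<and>
           aperiodic (hmc_kernel U h T) \<and>
           harris_recurrent (hmc_kernel U h T) \<and>
           (\<forall>q. (\<lambda>n. tv_norm (kpow (hmc_kernel U h T) n q) (target U)) \<longlonglongrightarrow> 0))"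
proof (intro allI impI)
  fix T :: nat assume T: "1 \<le> T"
  obtain L where L: "0 \<le> L" and lip: "\<And>q q'. norm (gradient U q - gradient U q') \<le> L * norm (q - q')"
    using assms(5) by blast
  \<comment> \<open>Then \<open>6 * (L + 1) * (h * real T)\<close> is at most 1, which bounds both
    \<open>h * real T\<close> and \<open>6 * L * (h * real T)\<close> by 1; their product is
    \<open>small\<close>. Using \<open>L + 1\<close> also covers \<open>L = 0\<close>.\<close>
  define ht where "ht = 1 / (6 * (L + 1) * real T)"
  have ht: "0 < ht" using L T by (simp add: ht_def)
  show "\<exists>ht > 0. \<forall>h. 0 < h \<and> h \<le> ht \<longrightarrow>
           irreducible (hmc_kernel U h T) \<and>
           irreducibility_measure (hmc_kernel U h T) lborel \<and>
           aperiodic (hmc_kernel U h T) \<and>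
           harris_recurrent (hmc_kernel U h T) \<and>
           (\<forall>q. (\<lambda>n. tv_norm (kpow (hmc_kernel U h T) n q) (target U)) \<longlonglongrightarrow> 0)"
  proof (intro exI[of _ ht] conjI[OF ht] allI impI)
    fix h assume h: "0 < h \<and> h \<le> ht"
    have "h * real T \<le> ht * real T" using h by (intro mult_right_mono) auto
    also have "\<dots> = 1 / (6 * (L + 1))" using T by (simp add: ht_def)
    finally have hT: "6 * (L + 1) * (h * real T) \<le> 1" using L by (simp add: field_simps)
    have hT0: "0 \<le> h * real T" using h by simp
    then have Lh: "0 \<le> L * (h * real T)" using L by simp
    then have "h * real T \<le> 1" "6 * L * (h * real T) \<le> 1"
      using hT hT0 by (auto simp: algebra_simps)
    then have "6 * L * (h * real T) * (h * real T) \<le> 1 * 1"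
      using hT0 by (intro mult_mono) auto
    then have small: "6 * L * (h * real T)\<^sup>2 \<le> 1" by (simp add: power2_eq_square mult.assoc)
    interpret hmc U h L T
      using C2_continuous[OF assms(3)] assms(4) lip L h T small by unfold_locales auto
    have "irreducible (hmc_kernel U h T)"
      unfolding irreducible_def by (rule exI) (rule irreducibility_measure_lborel)
    then show "irreducible (hmc_kernel U h T) \<and>
           irreducibility_measure (hmc_kernel U h T) lborel \<and>
           aperiodic (hmc_kernel U h T) \<and>
           harris_recurrent (hmc_kernel U h T) \<and>
           (\<forall>q. (\<lambda>n. tv_norm (kpow (hmc_kernel U h T) n q) (target U)) \<longlonglongrightarrow> 0)"
      by (intro conjI allI irreducibility_measure_lborel K_aperiodic K_harris_recurrent tv_norm_kpow_tendsto_0)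
  qed
qed

end
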